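(* Let $b$ be a locally integrable function on $\mathbb{R}^n$ and let $0<\beta<1$. Then the following assertions are equivalent: (1) $b\in \dot{\Lambda}_{\beta}(\mathbb{R}^n)$. (2) $M_b$ is bounded from $L^{p(\cdot)}(\mathbb{R}^n)$ to $L^{q(\cdot)}(\mathbb{R}^n)$ for all $(p(\cdot),q(\cdot))\in \mathscr{B}_{p,q}^{\beta}(\mathbb{R}^n)$. (3) $M_b$ is bounded from $L^{p(\cdot)}(\mathbb{R}^n)$ to $L^{q(\cdot)}(\mathbb{R}^n)$ for some $(p(\cdot),q(\cdot))\in \mathscr{B}_{p,q}^{\beta}(\mathbb{R}^n)$. (4) There exists some $(p(\cdot),q(\cdot))\in \mathscr{B}_{p,q}^{\beta}(\mathbb{R}^n)$ such that $$\sup_{Q} \frac1{|Q|^{\beta/n}}\frac{\|(b-b_{Q})\chi_{Q}\|_{L^{q(\cdot)}(\mathbb{R}^n)}}{\|\chi_{Q}\|_{L^{q(\cdot)}(\mathbb{R}^n)}} <\infty.$$ (5) For all $(p(\cdot),q(\cdot))\in \mathscr{B}_{p,q}^{\beta}(\mathbb{R}^n)$, $$\sup_{Q} \frac1{|Q|^{\beta/n}}\frac{\|(b-b_{Q})\chi_{Q}\|_{L^{q(\cdot)}(\mathbb{R}^n)}}{\|\chi_{Q}\|_{L^{q(\cdot)}(\mathbb{R}^n)}} <\infty.$$ In (4) and (5) the suprema are over all cubes $Q\subset\mathbb{R}^n$.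
   Context: Functions are real-valued and identified when equal almost everywhere; in particular $b\in\dot{\Lambda}_\beta(\mathbb{R}^n)$ means that $b$ agrees a.e. with a function satisfying the condition below. A cube $Q\subset\mathbb{R}^n$ always has sides parallel to the coordinate axes; $|Q|$ is its Lebesgue measure, $\chi_Q$ its characteristic function, and $f_Q=|Q|^{-1}\int_Q f(x)\,dx$ for $f\in L^1_{\rm loc}(\mathbb{R}^n)$. Lipschitz space: for $0<\beta<1$, $b\in\dot{\Lambda}_{\beta}(\mathbb{R}^n)$ if there is a constant $C$ with $|b(x)-b(y)|\le C|x-y|^{\beta}$ for all $x,y\in\mathbb{R}^n$. Hardy-Littlewood maximal function: $M(f)(x)=\sup_{Q\ni x}\frac1{|Q|}\int_Q|f(y)|\,dy$. Maximal commutator: $M_b(f)(x)=\sup_{Q\ni x}\frac1{|Q|}\int_Q|b(x)-b(y)||f(y)|\,dy$. Both suprema are over all cubes $Q\subset\mathbb{R}^n$ containing $x$. Variable exponent Lebesgue space: for measurable $p(\cdot):\mathbb{R}^n\to[1,\infty)$, $L^{p(\cdot)}(\mathbb{R}^n)$ is the set of measurable $f$ with $\int_{\mathbb{R}^n}(|f(x)|/\lambda)^{p(x)}dx<\infty$ for some $\lambda>0$, with norm $\|f\|_{L^{p(\cdot)}(\mathbb{R}^n)}=\inf\{\lambda>0:\int_{\mathbb{R}^n}(|f(x)|/\lambda)^{p(x)}dx\le1\}$ (equal to $\infty$ if $f\notin L^{p(\cdot)}(\mathbb{R}^n)$). An operator $T$ is bounded from $L^{p(\cdot)}(\mathbb{R}^n)$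 to $L^{q(\cdot)}(\mathbb{R}^n)$ if there is a constant $C$ such that, for all $f\in L^{p(\cdot)}(\mathbb{R}^n)$, $Tf$ is defined a.e. and $\|Tf\|_{L^{q(\cdot)}(\mathbb{R}^n)}\le C\|f\|_{L^{p(\cdot)}(\mathbb{R}^n)}$. $\mathscr{P}(\mathbb{R}^n)$ is the set of measurable $p(\cdot):\mathbb{R}^n\to[1,\infty)$ with $1<p_-:=\operatorname{ess\,inf}_{x}p(x)$ and $p_+:=\operatorname{ess\,sup}_{x}p(x)<\infty$. $\mathscr{B}(\mathbb{R}^n)$ is the set of $p(\cdot)\in\mathscr{P}(\mathbb{R}^n)$ such that $M$ is bounded on $L^{p(\cdot)}(\mathbb{R}^n)$. An ordered pair $(p(\cdot),q(\cdot))$ of variable exponents belongs to $\mathscr{B}^{\alpha}_{p,q}(\mathbb{R}^n)$ if $p(\cdot)\in\mathscr{P}(\mathbb{R}^n)$, $0<\alpha<n/p_+$, $1/q(\cdot)=1/p(\cdot)-\alpha/n$, and $q(\cdot)(n-\alpha)/n\in\mathscr{B}(\mathbb{R}^n)$. *)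

theory Defs
  imports "HOL-Analysis.Analysis" "HOL-Probability.Essential_Supremum"
begin

text \<open>
  Points are elements of \<^typ>\<open>real ^ 'n\<close>, so the dimension is \<^term>\<open>CARD('n)\<close>. All measure theory
  refers to \<^term>\<open>lebesgue\<close>. An almost-everywhere class of functions is given by an arbitrary
  representative; maximal functions and norms take values in \<^typ>\<open>ennreal\<close>.
\<close>

section \<open>Cubes and averages\<close>

text \<open>Cubes are closed and nondegenerate.\<close>

definition cubes :: "(real ^ 'n) set set" where
  "cubes = {cbox a (\<chi> i. a $ i + s) | a s. 0 < s}"

definition cube_average :: "(real ^ 'n \<Rightarrow> real) \<Rightarrow> (real ^ 'n) set \<Rightarrow> real" where
  "cube_average f Q = (1 / measure lebesgue Q) * set_lebesgue_integral lebesgue Q f"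

definition locally_integrable :: "(real ^ 'n \<Rightarrow> real) \<Rightarrow> bool" where
  "locally_integrable f \<longleftrightarrow> (\<forall>K. compact K \<longrightarrow> set_integrable lebesgue K f)"

section \<open>Lipschitz spaces\<close>

definition lipschitz_space :: "real \<Rightarrow> (real ^ 'n \<Rightarrow> real) set" where
  "lipschitz_space \<beta> = {b. \<exists>g. (AE x in lebesgue. b x = g x) \<and>
     (\<exists>C. \<forall>x y. \<bar>g x - g y\<bar> \<le> C * norm (x - y) powr \<beta>)}"

section \<open>Maximal operators\<close>

definition maximal_function :: "(real ^ 'n \<Rightarrow> real) \<Rightarrow> real ^ 'n \<Rightarrow> ennreal" where
  "maximal_function f x =
     (SUP Q \<in> {Q \<in> cubes. x \<in> Q}.
        (\<integral>\<^sup>+ y \<in> Q. ennreal \<bar>f y\<bar> \<partial>lebesgue) / emeasure lebesgue Q)"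

definition maximal_commutator ::
  "(real ^ 'n \<Rightarrow> real) \<Rightarrow> (real ^ 'n \<Rightarrow> real) \<Rightarrow> real ^ 'n \<Rightarrow> ennreal" where
  "maximal_commutator b f x =
     (SUP Q \<in> {Q \<in> cubes. x \<in> Q}.
        (\<integral>\<^sup>+ y \<in> Q. ennreal (\<bar>b x - b y\<bar> * \<bar>f y\<bar>) \<partial>lebesgue) / emeasure lebesgue Q)"

section \<open>Variable exponent Lebesgue spaces\<close>

definition variable_exponent :: "(real ^ 'n \<Rightarrow> real) \<Rightarrow> bool" where
  "variable_exponent p \<longleftrightarrow> p \<in> borel_measurable lebesgue \<and> (\<forall>x. 1 \<le> p x)"

definition modular :: "(real ^ 'n \<Rightarrow> real) \<Rightarrow> (real ^ 'n \<Rightarrow> real) \<Rightarrow> ennreal" where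
  "modular p f = (\<integral>\<^sup>+ x. ennreal (\<bar>f x\<bar> powr p x) \<partial>lebesgue)"

definition Lvar :: "(real ^ 'n \<Rightarrow> real) \<Rightarrow> (real ^ 'n \<Rightarrow> real) set" where
  "Lvar p = {f \<in> borel_measurable lebesgue. \<exists>t>0. modular p (\<lambda>x. \<bar>f x\<bar> / t) < \<infinity>}"

definition Lvar_norm :: "(real ^ 'n \<Rightarrow> real) \<Rightarrow> (real ^ 'n \<Rightarrow> real) \<Rightarrow> ennreal" where
  "Lvar_norm p f =
     (if f \<in> Lvar p
      then INF t \<in> {t::real. 0 < t \<and> modular p (\<lambda>x. \<bar>f x\<bar> / t) \<le> 1}. ennreal t
      else \<infinity>)"

text \<open>
  Since functions are real-valued, ``\<open>T f\<close> is defined almost everywhere'' means that the extended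
  value \<open>T f x\<close> is finite for almost every \<open>x\<close>; \<^const>\<open>enn2real\<close> only alters the remaining null set.
\<close>

definition bounded_operator ::
  "((real ^ 'n \<Rightarrow> real) \<Rightarrow> real ^ 'n \<Rightarrow> ennreal) \<Rightarrow>
   (real ^ 'n \<Rightarrow> real) \<Rightarrow> (real ^ 'n \<Rightarrow> real) \<Rightarrow> bool" where
  "bounded_operator T p q \<longleftrightarrow>
     (\<exists>C::real. 0 \<le> C \<and> (\<forall>f \<in> Lvar p.
        (AE x in lebesgue. T f x < \<infinity>) \<and>
        Lvar_norm q (\<lambda>x. enn2real (T f x)) \<le> ennreal C * Lvar_norm p f))"

section \<open>Classes of exponents\<close>

definition exponent_sup :: "(real ^ 'n \<Rightarrow> real) \<Rightarrow> ereal" where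
  "exponent_sup p = esssup lebesgue (\<lambda>x. ereal (p x))"

definition exponent_inf :: "(real ^ 'n \<Rightarrow> real) \<Rightarrow> ereal" where
  "exponent_inf p = Sup {c. AE x in lebesgue. c \<le> ereal (p x)}"

definition exponents_P :: "(real ^ 'n \<Rightarrow> real) set" where
  "exponents_P = {p. variable_exponent p \<and> 1 < exponent_inf p \<and> exponent_sup p < \<infinity>}"

definition exponents_B :: "(real ^ 'n \<Rightarrow> real) set" where
  "exponents_B = {p \<in> exponents_P. bounded_operator maximal_function p p}"

definition exponent_pairs_B :: "real \<Rightarrow> ((real ^ 'n \<Rightarrow> real) \<times> (real ^ 'n \<Rightarrow> real)) set" where
  "exponent_pairs_B \<alpha> = {(p, q).
     variable_exponent p \<and> variable_exponent q \<and> p \<in> exponents_P \<and>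
     0 < \<alpha> \<and> ereal \<alpha> < ereal (real CARD('n)) / exponent_sup p \<and>
     (\<forall>x. 1 / q x = 1 / p x - \<alpha> / real CARD('n)) \<and>
     (\<lambda>x. q x * (real CARD('n) - \<alpha>) / real CARD('n)) \<in> exponents_B}"

section \<open>Mean oscillation\<close>

definition oscillation_sup :: "real \<Rightarrow> (real ^ 'n \<Rightarrow> real) \<Rightarrow> (real ^ 'n \<Rightarrow> real) \<Rightarrow> ennreal" where
  "oscillation_sup \<beta> q b =
     (SUP Q \<in> cubes.
        ennreal (1 / measure lebesgue Q powr (\<beta> / real CARD('n))) *
        (Lvar_norm q (\<lambda>x. (b x - cube_average b Q) * indicator Q x) / Lvar_norm q (indicator Q)))"

end

theory Submission
  imports Defs
begin

text \<open>
  Put \<open>\<theta> = 1 - \<beta> / n\<close> and \<open>r = \<theta> q\<close>, so that \<open>M\<close> is bounded on \<open>L\<^sup>r\<close>.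
  If \<open>b\<close> is Lipschitz, \<open>M\<^sub>b f\<close> is dominated by the fractional maximal function of \<open>f\<close>, and Hoelder's
  inequality bounds the latter by \<open>M (\<bar>f\<bar> powr (p / r)) powr \<theta>\<close> when \<open>f\<close> has modular at most 1; the
  modular of \<open>\<bar>f\<bar> powr (p / r)\<close> with respect to \<open>r\<close> is that of \<open>f\<close> with respect to \<open>p\<close>.
  Conversely \<open>\<bar>b - b\<^sub>Q\<bar> \<le> M\<^sub>b \<chi>\<^sub>Q\<close> on \<open>Q\<close> and \<open>\<parallel>\<chi>\<^sub>Q\<parallel>\<^sub>p \<le> 2 \<bar>Q\<bar> powr (\<beta> / n) \<parallel>\<chi>\<^sub>Q\<parallel>\<^sub>q\<close> give the
  oscillation bound. Applying \<open>M\<close> to \<open>\<bar>b - b\<^sub>Q\<bar> powr (1 / \<theta>) \<chi>\<^sub>Q\<close> turns it into an \<open>L\<^sup>1\<close> bound on the mean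
  oscillation, whence \<open>b\<close> is Lipschitz by Campanato's argument: averages over cubes shrinking to a
  Lebesgue point telescope. Some pair of exponents is always available because \<open>M\<close> is bounded on \<open>L\<^sup>2\<close>.
\<close>

text \<open>The obstacle is that the exponents vary with the point: passing from \<open>f\<close> to
  \<open>\<bar>f\<bar> powr (p / r)\<close> is not homogeneous, so it respects modulars but not
  norms. Operator bounds are therefore restated as implications between conditions "modular at most
  1" at each scale \<open>t\<close>, and a function is divided by \<open>t\<close> before any power
  is taken. The relation between \<open>p\<close> and \<open>q\<close> enters as the pointwise
  identity \<open>p / q + p * (1 - \<theta>) = 1\<close>. It splits \<open>F\<close> into
  \<open>F powr (p / q) * F powr (p * (1 - \<theta>))\<close> for Hoelder's inequality and supplies
  the weights in Young's inequality, while \<open>\<beta> + n * \<theta> = n\<close> cancels the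
  side of the cube. In the converse, the constant power \<open>1 / \<theta>\<close> carries
  \<open>q\<close>-modulars to \<open>r\<close>-modulars. The mean of the powered function over
  \<open>Q\<close> is a lower bound for its maximal function on all of \<open>Q\<close>, so the
  bound for \<open>M\<close> compares that mean with the norm of the indicator of \<open>Q\<close>.
  A pair of exponents must exist because otherwise (2) and (5) would hold vacuously.\<close>

text \<open>As a simp rule, it replaces \<^term>\<open>emeasure lebesgue S\<close> by the measure of the Borel part of \<open>S\<close>.\<close>

declare emeasure_completion [simp del]

section \<open>Cubes\<close>

text \<open>Indexed by the lower corner: cubes with a common corner are nested in \<open>s\<close>,
  and they are the boxes \<open>cbox x (x + h *\<^sub>R One)\<close> over which the differentiation
  theorem averages.\<close>

definition cube :: "real ^ 'n \<Rightarrow> real \<Rightarrow> (real ^ 'n) set" where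
  "cube a s = cbox a (\<chi> i. a $ i + s)"

lemma cubes_eq: "cubes = {cube a s | a s. 0 < s}"
  by (simp add: cubes_def cube_def)

lemma cube_in_cubes [simp]: "0 < s \<Longrightarrow> cube a s \<in> cubes"
  by (auto simp: cubes_eq)

lemma cubesE:
  assumes "Q \<in> cubes"
  obtains a s where "Q = cube a s" "0 < s"
  using assms by (auto simp: cubes_eq)

lemma mem_cube: "x \<in> cube a s \<longleftrightarrow> (\<forall>i. a $ i \<le> x $ i \<and> x $ i \<le> a $ i + s)"
  by (simp add: cube_def mem_box_cart)

lemma compact_cube: "compact (cube a s)"
  by (simp add: cube_def)

lemma cube_sets [measurable, simp]: "cube a s \<in> sets lebesgue"
  by (simp add: cube_def)

lemma measure_cube:
  fixes a :: "real ^ 'n"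
  assumes "0 \<le> s"
  shows "measure lebesgue (cube a s) = s ^ CARD('n)"
proof -
  have "a \<in> cbox a (\<chi> i. a $ i + s)"
    using assms by (simp add: mem_box_cart)
  then have "cbox a (\<chi> i. a $ i + s) \<noteq> {}"
    by blast
  then show ?thesis
    by (simp add: cube_def content_cbox_cart)
qed

lemma emeasure_cube:
  fixes a :: "real ^ 'n"
  assumes "0 \<le> s"
  shows "emeasure lebesgue (cube a s) = ennreal (s ^ CARD('n))"
proof -
  have "cube a s \<in> lmeasurable"
    by (simp add: cube_def)
  then show ?thesis
    using measure_cube[OF assms, of a] by (simp add: emeasure_eq_measure2)
qed

text \<open>Each coordinate differs by at most \<open>s\<close>, and the norm is at most the sum
  over coordinates. This is the origin of the factor \<open>real CARD('n)\<close> in later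
  constants.\<close>

lemma norm_diff_cube:
  fixes a :: "real ^ 'n"
  assumes "x \<in> cube a s" "y \<in> cube a s"
  shows "norm (x - y) \<le> real CARD('n) * s"
proof -
  have "norm (x - y) \<le> (\<Sum>i\<in>UNIV. \<bar>(x - y) $ i\<bar>)"
    by (rule norm_le_l1_cart)
  also have "\<dots> \<le> (\<Sum>i\<in>(UNIV :: 'n set). s)"
  proof (rule sum_mono)
    fix i
    show "\<bar>(x - y) $ i\<bar> \<le> s"
      using assms[unfolded mem_cube, THEN spec, of i] by auto
  qed
  finally show ?thesis by simp
qed

lemma cube_subset_cball:
  fixes a :: "real ^ 'n"
  assumes "x \<in> cube a s"
  shows "cube a s \<subseteq> cball x (real CARD('n) * s)"
  using norm_diff_cube[OF assms] by (auto simp: dist_norm)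

section \<open>Measurability of maximal operators\<close>

text \<open>Completion does not change the measure of Borel sets, so a countable cover for
  \<open>lborel\<close> also serves \<open>lebesgue\<close>. It is needed for integrals depending on
  a parameter and for Fubini's theorem.\<close>

lemma sigma_finite_lebesgue: "sigma_finite_measure (lebesgue :: 'a :: euclidean_space measure)"
proof
  obtain A :: "'a set set" where A: "countable A" "A \<subseteq> sets lborel" "\<Union> A = space lborel"
      "\<forall>a\<in>A. emeasure lborel a \<noteq> \<infinity>"
    using sigma_finite_measure.sigma_finite_countable[OF sigma_finite_lborel] by blast
  then show "\<exists>A :: 'a set set. countable A \<and> A \<subseteq> sets lebesgue \<and> \<Union> A = space lebesgue \<and>
      (\<forall>a\<in>A. emeasure lebesgue a \<noteq> \<infinity>)"
    by (intro exI[of _ A]) (use A in \<open>auto simp: emeasure_completion\<close>)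
qed

text \<open>
  Enlarging a cube slightly changes the average as little as desired, so a countable dense family of
  cubes computes the supremum.
\<close>

lemma borel_measurable_SUP_cubes:
  fixes F :: "real ^ 'n \<Rightarrow> real ^ 'n \<Rightarrow> ennreal"
  assumes F [measurable]: "case_prod F \<in> borel_measurable (lebesgue \<Otimes>\<^sub>M lebesgue)"
  shows "(\<lambda>x. SUP Q \<in> {Q \<in> cubes. x \<in> Q}. (\<integral>\<^sup>+ y \<in> Q. F x y \<partial>lebesgue) / emeasure lebesgue Q)
           \<in> borel_measurable lebesgue"
proof -
  interpret sigma_finite_measure "lebesgue :: (real ^ 'n) measure"
    by (rule sigma_finite_lebesgue)
  define avg where "avg Q x = (\<integral>\<^sup>+ y \<in> Q. F x y \<partial>lebesgue) / emeasure lebesgue Q" for Q x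
  obtain D :: "((real ^ 'n) \<times> real) set" where "countable D"
    and D: "\<And>X. open X \<Longrightarrow> X \<noteq> {} \<Longrightarrow> \<exists>d\<in>D. d \<in> X"
    by (rule countable_dense_setE) blast
  define R where "R = {(a, s) \<in> D. 0 < s}"
  have "countable R"
    using \<open>countable D\<close> by (rule countable_subset[rotated]) (auto simp: R_def)
  have [measurable]: "avg (cube a s) \<in> borel_measurable lebesgue" for a s
    unfolding avg_def by measurable
  \<comment> \<open>The indicator replaces the condition \<open>x \<in> Q\<close> by the value 0, so
    the index set on the right does not depend on \<open>x\<close>.\<close>
  have eq: "(SUP Q \<in> {Q \<in> cubes. x \<in> Q}. avg Q x) =
        (SUP (a, s) \<in> R. avg (cube a s) x * indicator (cube a s) x)" for x
  proof (rule antisym)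
    show "(SUP (a, s) \<in> R. avg (cube a s) x * indicator (cube a s) x) \<le> (SUP Q \<in> {Q \<in> cubes. x \<in> Q}. avg Q x)"
      by (rule SUP_least) (auto simp: R_def indicator_def intro!: SUP_upper)
  next
    let ?S = "SUP (a, s) \<in> R. avg (cube a s) x * indicator (cube a s) x"
    show "(SUP Q \<in> {Q \<in> cubes. x \<in> Q}. avg Q x) \<le> ?S"
    proof (rule SUP_least, clarify)
      fix Q assume Q: "Q \<in> cubes" "x \<in> Q"
      then obtain a s where Q_eq: "Q = cube a s" and s: "0 < s"
        by (elim cubesE)
      let ?I = "\<integral>\<^sup>+ y \<in> Q. F x y \<partial>lebesgue"
      \<comment> \<open>The new corner lies less than \<open>\<delta>\<close> below \<open>a\<close>
        in each coordinate. A side above \<open>s + \<delta>\<close> compensates for this shift, and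
        a side below \<open>s + 2 * \<delta>\<close> controls the volume.\<close>
      have I: "?I \<le> ?S * ennreal ((s + 2 * \<delta>) ^ CARD('n))" if "0 < \<delta>" for \<delta>
      proof -
        have "a - (\<chi> i. \<delta> / 2) \<in> box (a - (\<chi> i. \<delta>)) a"
          using that by (simp add: mem_box_cart)
        then have "box (a - (\<chi> i. \<delta>)) a \<times> {s + \<delta> <..< s + 2 * \<delta>} \<noteq> {}"
          using that by auto
        then have "\<exists>d\<in>D. d \<in> box (a - (\<chi> i. \<delta>)) a \<times> {s + \<delta> <..< s + 2 * \<delta>}"
          by (rule D[rotated]) (intro open_Times open_box open_greaterThanLessThan)
        then obtain a' s' where as': "(a', s') \<in> D" "a' \<in> box (a - (\<chi> i. \<delta>)) a" "s' \<in> {s + \<delta> <..< s + 2 * \<delta>}"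
          by auto
        then have R: "(a', s') \<in> R" and s': "0 < s'"
          using s that by (auto simp: R_def)
        have sub: "Q \<subseteq> cube a' s'"
        proof
          fix y assume "y \<in> Q"
          show "y \<in> cube a' s'"
            unfolding mem_cube
          proof
            fix i
            have "a $ i \<le> y $ i \<and> y $ i \<le> a $ i + s"
              using \<open>y \<in> Q\<close> by (simp add: Q_eq mem_cube)
            moreover have "a $ i - \<delta> < a' $ i \<and> a' $ i < a $ i"
              using as'(2) by (simp add: mem_box_cart)
            ultimately show "a' $ i \<le> y $ i \<and> y $ i \<le> a' $ i + s'"
              using as'(3) by auto
          qed
        qed
        have "avg (cube a' s') x = avg (cube a' s') x * indicator (cube a' s') x"
          using sub Q by auto
        also have "\<dots> \<le> ?S"
          using R by (intro SUP_upper2[OF R]) auto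
        finally have le: "avg (cube a' s') x \<le> ?S" .
        have "?I \<le> (\<integral>\<^sup>+ y \<in> cube a' s'. F x y \<partial>lebesgue)"
          using sub by (intro nn_integral_mono) (auto simp: indicator_def)
        also have "\<dots> = avg (cube a' s') x * ennreal (s' ^ CARD('n))"
          using s' by (simp add: avg_def emeasure_cube ennreal_divide_times)
        also have "\<dots> \<le> ?S * ennreal ((s + 2 * \<delta>) ^ CARD('n))"
          using as'(3) s' by (intro mult_mono le ennreal_leI power_mono) auto
        finally show ?thesis .
      qed
      have "?I \<le> ?S * ennreal (s ^ CARD('n))"
      \<comment> \<open>Letting \<open>\<delta>\<close> tend to 0 needs continuity of multiplication
        by \<open>?S\<close>, hence a finite \<open>?S\<close>. If \<open>?S\<close> is
        \<open>top\<close>, then \<open>0 < s\<close> makes the right-hand side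
        \<open>top\<close>.\<close>
      proof (cases "?S = top")
        case True
        then show ?thesis
          unfolding True using s by (simp add: ennreal_top_mult)
      next
        case False
        have "((\<lambda>\<delta>. ?S * ennreal ((s + 2 * \<delta>) ^ CARD('n))) \<longlongrightarrow> ?S * ennreal ((s + 2 * 0) ^ CARD('n))) (at_right 0)"
          using False by (intro ennreal_tendsto_cmult tendsto_ennrealI tendsto_intros)
              (auto simp: top.not_eq_extremum)
        moreover have "\<forall>\<^sub>F \<delta> in at_right (0::real). ?I \<le> ?S * ennreal ((s + 2 * \<delta>) ^ CARD('n))"
          using I by (auto simp: eventually_at_right_field intro: exI[of _ 1])
        ultimately show ?thesis
          by (intro tendsto_lowerbound[of _ _ "at_right (0::real)"]) auto
      qed
      then show "avg Q x \<le> ?S"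
        using s unfolding avg_def Q_eq
        by (simp add: emeasure_cube divide_le_posI_ennreal mult.commute)
    qed
  qed
  have "(\<lambda>x. SUP (a, s) \<in> R. avg (cube a s) x * indicator (cube a s) x) \<in> borel_measurable lebesgue"
    using \<open>countable R\<close> by (intro borel_measurable_SUP) auto
  then show ?thesis
    unfolding avg_def[symmetric] eq .
qed

lemma borel_measurable_maximal_function:
  assumes [measurable]: "f \<in> borel_measurable lebesgue"
  shows "maximal_function f \<in> borel_measurable lebesgue"
  using borel_measurable_SUP_cubes[of "\<lambda>x y. ennreal \<bar>f y\<bar>"]
  by (simp add: maximal_function_def[abs_def])

lemma borel_measurable_maximal_commutator:
  assumes [measurable]: "f \<in> borel_measurable lebesgue" "b \<in> borel_measurable lebesgue"
  shows "maximal_commutator b f \<in> borel_measurable lebesgue"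
  using borel_measurable_SUP_cubes[of "\<lambda>x y. ennreal (\<bar>b x - b y\<bar> * \<bar>f y\<bar>)"]
  by (simp add: maximal_commutator_def[abs_def])

section \<open>Variable exponent norms\<close>

lemma variable_exponent_measurable: "variable_exponent p \<Longrightarrow> p \<in> borel_measurable lebesgue"
  by (simp add: variable_exponent_def)

lemma variable_exponent_ge1: "variable_exponent p \<Longrightarrow> 1 \<le> p x"
  by (simp add: variable_exponent_def)

lemma modular_mono_AE:
  assumes "variable_exponent p" "AE x in lebesgue. \<bar>f x\<bar> \<le> \<bar>g x\<bar>"
  shows "modular p f \<le> modular p g"
  unfolding modular_def
proof (rule nn_integral_mono_AE)
  show "AE x in lebesgue. ennreal (\<bar>f x\<bar> powr p x) \<le> ennreal (\<bar>g x\<bar> powr p x)"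
    using assms(2)
  proof eventually_elim
    case (elim x)
    then show ?case
      using variable_exponent_ge1[OF assms(1), of x] by (intro ennreal_leI powr_mono2) auto
  qed
qed

lemma Lvar_norm_leI:
  assumes "f \<in> borel_measurable lebesgue" "0 < t" "modular p (\<lambda>x. \<bar>f x\<bar> / t) \<le> 1"
  shows "Lvar_norm p f \<le> ennreal t"
proof -
  have "modular p (\<lambda>x. \<bar>f x\<bar> / t) < \<infinity>"
    using assms(3) by (rule le_less_trans) simp
  then have "f \<in> Lvar p"
    using assms by (auto simp: Lvar_def)
  then show ?thesis
    using assms by (auto simp: Lvar_norm_def intro!: INF_lower)
qed

text \<open>Strictness avoids asking whether the infimum is attained: some admissible
  \<open>u\<close> lies below \<open>t\<close>, and the modular decreases as the scale
  grows.\<close>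

lemma Lvar_norm_lessD:
  assumes p: "variable_exponent p" and less: "Lvar_norm p f < ennreal t"
  shows "f \<in> Lvar p" "0 < t" "modular p (\<lambda>x. \<bar>f x\<bar> / t) \<le> 1"
proof -
  show f: "f \<in> Lvar p"
    using less by (auto simp: Lvar_norm_def split: if_splits)
  then obtain u where u: "0 < u" "modular p (\<lambda>x. \<bar>f x\<bar> / u) \<le> 1" "ennreal u < ennreal t"
    using less by (auto simp: Lvar_norm_def INF_less_iff)
  then have ut: "u < t"
    by (simp add: ennreal_less_iff)
  then show "0 < t"
    using u by simp
  have "\<bar>f x\<bar> / t \<le> \<bar>f x\<bar> / u" for x
    using u ut by (intro divide_left_mono) auto
  then have "modular p (\<lambda>x. \<bar>f x\<bar> / t) \<le> modular p (\<lambda>x. \<bar>f x\<bar> / u)"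
    using p u ut by (intro modular_mono_AE) auto
  then show "modular p (\<lambda>x. \<bar>f x\<bar> / t) \<le> 1"
    using u by simp
qed

text \<open>Reduces a norm inequality to comparing the unit balls of the two modulars at every scale
  \<open>t\<close>.\<close>

lemma Lvar_norm_le_cmult:
  assumes p: "variable_exponent p" and g: "g \<in> borel_measurable lebesgue" and c: "0 < c"
    and modular: "\<And>t. 0 < t \<Longrightarrow> modular p (\<lambda>x. \<bar>f x\<bar> / t) \<le> 1 \<Longrightarrow> modular q (\<lambda>x. \<bar>g x\<bar> / (c * t)) \<le> 1"
  shows "Lvar_norm q g \<le> ennreal c * Lvar_norm p f"
proof (cases "Lvar_norm p f")
  case (real N)
  show ?thesis
  proof (rule ennreal_le_epsilon)
    fix e :: real assume e: "0 < e"
    \<comment> \<open>A scale strictly above the norm \<open>N\<close> is admissible. The excess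
      \<open>e / c\<close> becomes \<open>e\<close> after multiplication by \<open>c\<close> and
      keeps the scale positive if \<open>N = 0\<close>.\<close>
    let ?t = "N + e / c"
    have t: "0 < ?t"
      using real e c by (simp add: add_nonneg_pos)
    have "Lvar_norm p f < ennreal ?t"
      using real e c by (simp add: ennreal_less_iff)
    then have "modular q (\<lambda>x. \<bar>g x\<bar> / (c * ?t)) \<le> 1"
      using Lvar_norm_lessD[OF p] by (intro modular) auto
    then have "Lvar_norm q g \<le> ennreal (c * ?t)"
      using g c t by (intro Lvar_norm_leI) auto
    also have "c * ?t = c * N + e"
      using c by (simp add: field_simps)
    also have "ennreal (c * N + e) = ennreal c * Lvar_norm p f + ennreal e"
      using real c e by (simp add: ennreal_mult ennreal_plus)
    finally show "Lvar_norm q g \<le> ennreal c * Lvar_norm p f + ennreal e" .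
  qed
qed (use c in \<open>simp add: ennreal_mult_top\<close>)

lemma Lvar_norm_mono_AE:
  assumes q: "variable_exponent q" and g: "g \<in> borel_measurable lebesgue" and c: "0 < c"
    and le: "AE x in lebesgue. \<bar>g x\<bar> \<le> c * \<bar>f x\<bar>"
  shows "Lvar_norm q g \<le> ennreal c * Lvar_norm q f"
proof (rule Lvar_norm_le_cmult[OF q g c])
  fix t :: real assume t: "0 < t" "modular q (\<lambda>x. \<bar>f x\<bar> / t) \<le> 1"
  have "AE x in lebesgue. \<bar>\<bar>g x\<bar> / (c * t)\<bar> \<le> \<bar>\<bar>f x\<bar> / t\<bar>"
    using le by eventually_elim (use c t in \<open>simp add: field_simps\<close>)
  then have "modular q (\<lambda>x. \<bar>g x\<bar> / (c * t)) \<le> modular q (\<lambda>x. \<bar>f x\<bar> / t)"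
    by (rule modular_mono_AE[OF q])
  then show "modular q (\<lambda>x. \<bar>g x\<bar> / (c * t)) \<le> 1"
    using t by simp
qed

text \<open>Outside \<open>Q\<close> the integrand is 0 because \<open>0 powr y = 0\<close> for
  every \<open>y\<close>.\<close>

lemma modular_indicator:
  "modular q (\<lambda>x. \<bar>indicator Q x\<bar> / t) = (\<integral>\<^sup>+ x \<in> Q. ennreal ((1 / \<bar>t\<bar>) powr q x) \<partial>lebesgue)"
  unfolding modular_def by (intro nn_integral_cong) (auto simp: indicator_def)

text \<open>Positivity and finiteness allow this norm to be cancelled, as in the quotients of
  \<open>oscillation_sup\<close>.\<close>

lemma Lvar_norm_indicator:
  assumes q: "variable_exponent q" and Q [measurable]: "Q \<in> sets lebesgue"
    and m: "emeasure lebesgue Q = ennreal m" "0 < m"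
  shows "0 < Lvar_norm q (indicator Q)" "Lvar_norm q (indicator Q) < top"
proof -
  have [measurable]: "indicator Q \<in> borel_measurable lebesgue"
    by measurable
  have const: "(\<integral>\<^sup>+ x \<in> Q. ennreal (1 / t) \<partial>lebesgue) = ennreal (m / t)" if "0 < t" for t
    using that m by (simp add: nn_integral_cmult_indicator ennreal_mult[symmetric])
  \<comment> \<open>As \<open>1 / t\<close> is at most 1 and \<open>q\<close> at least 1, the
    modular at scale \<open>t\<close> is at most \<open>m / t\<close>, hence at most 1.\<close>
  define t where "t = max 1 m"
  have "modular q (\<lambda>x. \<bar>indicator Q x\<bar> / t) \<le> (\<integral>\<^sup>+ x \<in> Q. ennreal (1 / t) \<partial>lebesgue)"
    unfolding modular_indicator
  proof (intro nn_integral_mono mult_right_mono ennreal_leI)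
    fix x
    have "(1 / \<bar>t\<bar>) powr q x \<le> (1 / \<bar>t\<bar>) powr 1"
      using variable_exponent_ge1[OF q, of x] by (intro powr_mono') (auto simp: t_def)
    then show "(1 / \<bar>t\<bar>) powr q x \<le> 1 / t"
      by (simp add: t_def)
  qed simp
  also have "\<dots> = ennreal (m / t)"
    by (rule const) (simp add: t_def)
  also have "\<dots> \<le> 1"
    by (simp add: t_def)
  finally have "Lvar_norm q (indicator Q) \<le> ennreal t"
    by (intro Lvar_norm_leI) (auto simp: t_def)
  then show "Lvar_norm q (indicator Q) < top"
    by (rule le_less_trans) simp
  \<comment> \<open>Here \<open>1 / u\<close> is at least 1, so the modular at scale
    \<open>u\<close> is at least \<open>m / u\<close>, which exceeds 1.\<close>
  define u where "u = min 1 (m / 2)"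
  have u: "0 < u" "u \<le> 1" "u < m"
    using m by (auto simp: u_def)
  have "\<not> Lvar_norm q (indicator Q) < ennreal u"
  proof
    assume "Lvar_norm q (indicator Q) < ennreal u"
    then have le: "modular q (\<lambda>x. \<bar>indicator Q x\<bar> / u) \<le> 1"
      by (rule Lvar_norm_lessD[OF q])
    have "(\<integral>\<^sup>+ x \<in> Q. ennreal (1 / u) \<partial>lebesgue) \<le> modular q (\<lambda>x. \<bar>indicator Q x\<bar> / u)"
      unfolding modular_indicator
    proof (intro nn_integral_mono mult_right_mono ennreal_leI)
      fix x
      have "(1 / u) powr 1 \<le> (1 / u) powr q x"
        using variable_exponent_ge1[OF q, of x] u by (intro powr_mono) auto
      then show "1 / u \<le> (1 / \<bar>u\<bar>) powr q x"
        using u by simp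
    qed simp
    then have "ennreal (m / u) \<le> 1"
      unfolding const[OF u(1)] using le by (rule order_trans)
    then show False
      using u by (simp add: field_simps)
  qed
  then show "0 < Lvar_norm q (indicator Q)"
    using u by (metis ennreal_zero_less_divide ennreal_less_zero_iff not_le order_less_le_trans)
qed

lemma bounded_operator_modularD:
  assumes "bounded_operator T p q" and q: "variable_exponent q"
  obtains C where "0 < C"
    "\<And>f. f \<in> Lvar p \<Longrightarrow> AE x in lebesgue. T f x < \<infinity>"
    "\<And>f t. f \<in> borel_measurable lebesgue \<Longrightarrow> 0 < t \<Longrightarrow> modular p (\<lambda>x. \<bar>f x\<bar> / t) \<le> 1 \<Longrightarrow>
       modular q (\<lambda>x. \<bar>enn2real (T f x)\<bar> / (C * t)) \<le> 1"
proof -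
  obtain C where C: "0 \<le> C" "\<And>f. f \<in> Lvar p \<Longrightarrow> AE x in lebesgue. T f x < \<infinity>"
    "\<And>f. f \<in> Lvar p \<Longrightarrow> Lvar_norm q (\<lambda>x. enn2real (T f x)) \<le> ennreal C * Lvar_norm p f"
    using assms(1) unfolding bounded_operator_def by blast
  show ?thesis
  \<comment> \<open>The gap between \<open>C * t\<close> and \<open>(C + 1) * t\<close> provides the
    strict inequality that \<open>Lvar_norm_lessD\<close> asks for; it also makes the constant
    positive.\<close>
  proof (rule that[of "C + 1"])
    fix f t assume f: "f \<in> borel_measurable lebesgue" and t: "0 < t" "modular p (\<lambda>x. \<bar>f x\<bar> / t) \<le> 1"
    have "modular p (\<lambda>x. \<bar>f x\<bar> / t) < \<infinity>"
      using t(2) by (rule le_less_trans) simp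
    then have "f \<in> Lvar p"
      using f t by (auto simp: Lvar_def)
    then have "Lvar_norm q (\<lambda>x. enn2real (T f x)) \<le> ennreal C * Lvar_norm p f"
      by (rule C)
    also have "\<dots> \<le> ennreal C * ennreal t"
      using Lvar_norm_leI[OF f t] by (rule mult_left_mono) simp
    also have "\<dots> < ennreal ((C + 1) * t)"
      using C(1) t by (simp add: ennreal_mult[symmetric] ennreal_less_iff)
    finally show "modular q (\<lambda>x. \<bar>enn2real (T f x)\<bar> / ((C + 1) * t)) \<le> 1"
      by (rule Lvar_norm_lessD[OF q])
  qed (use C in auto)
qed

lemma bounded_operatorI:
  assumes p: "variable_exponent p" and C: "0 < C"
    and meas: "\<And>f. f \<in> borel_measurable lebesgue \<Longrightarrow> T f \<in> borel_measurable lebesgue"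
    and fin: "\<And>f. f \<in> Lvar p \<Longrightarrow> AE x in lebesgue. T f x < \<infinity>"
    and modular: "\<And>f t. f \<in> borel_measurable lebesgue \<Longrightarrow> 0 < t \<Longrightarrow> modular p (\<lambda>x. \<bar>f x\<bar> / t) \<le> 1 \<Longrightarrow>
       modular q (\<lambda>x. \<bar>enn2real (T f x)\<bar> / (C * t)) \<le> 1"
  shows "bounded_operator T p q"
  unfolding bounded_operator_def
proof (intro exI[of _ C] conjI ballI)
  fix f assume f: "f \<in> Lvar p"
  then have f': "f \<in> borel_measurable lebesgue"
    by (simp add: Lvar_def)
  note [measurable] = meas[OF f']
  have "(\<lambda>x. enn2real (T f x)) \<in> borel_measurable lebesgue"
    by measurable
  then show "Lvar_norm q (\<lambda>x. enn2real (T f x)) \<le> ennreal C * Lvar_norm p f"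
    using C modular[OF f'] by (intro Lvar_norm_le_cmult[OF p]) auto
qed (use fin C in auto)

section \<open>Hoelder's inequality\<close>

text \<open>Young's inequality for \<open>F / A\<close> and \<open>G / B\<close>, integrated. The
  hypotheses are upper bounds for the integrals because bounds are what estimates of maximal
  functions and modulars provide.\<close>

lemma nn_integral_Holder:
  fixes F G :: "'a \<Rightarrow> real"
  assumes [measurable]: "F \<in> borel_measurable M" "G \<in> borel_measurable M"
    and F: "\<And>x. 0 \<le> F x" and G: "\<And>x. 0 \<le> G x" and \<theta>: "0 < \<theta>" "\<theta> < 1"
    and A: "(\<integral>\<^sup>+ x. ennreal (F x) \<partial>M) \<le> ennreal A" "0 \<le> A"
    and B: "(\<integral>\<^sup>+ x. ennreal (G x) \<partial>M) \<le> ennreal B" "0 \<le> B"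
  shows "(\<integral>\<^sup>+ x. ennreal (F x powr \<theta> * G x powr (1 - \<theta>)) \<partial>M) \<le> ennreal (A powr \<theta> * B powr (1 - \<theta>))"
\<comment> \<open>If one bound is 0, that function vanishes almost everywhere, and so does the
  product; otherwise division by \<open>A\<close> and \<open>B\<close> makes sense.\<close>
proof (cases "A = 0 \<or> B = 0")
  case True
  have "AE x in M. F x = 0 \<or> G x = 0"
    using True
  proof
    assume "A = 0"
    then have "(\<integral>\<^sup>+ x. ennreal (F x) \<partial>M) = 0"
      using A by simp
    then have "AE x in M. ennreal (F x) = 0"
      by (subst (asm) nn_integral_0_iff_AE) auto
    then show ?thesis
      by eventually_elim (use F in \<open>auto simp: ennreal_eq_0_iff intro: antisym\<close>)
  next
    assume "B = 0"
    then have "(\<integral>\<^sup>+ x. ennreal (G x) \<partial>M) = 0"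
      using B by simp
    then have "AE x in M. ennreal (G x) = 0"
      by (subst (asm) nn_integral_0_iff_AE) auto
    then show ?thesis
      by eventually_elim (use G in \<open>auto simp: ennreal_eq_0_iff intro: antisym\<close>)
  qed
  then have "AE x in M. ennreal (F x powr \<theta> * G x powr (1 - \<theta>)) = 0"
    by eventually_elim auto
  then have "(\<integral>\<^sup>+ x. ennreal (F x powr \<theta> * G x powr (1 - \<theta>)) \<partial>M) = 0"
    by (subst nn_integral_0_iff_AE) auto
  then show ?thesis by simp
next
  case False
  then have pos: "0 < A" "0 < B"
    using A B by auto
  let ?K = "A powr \<theta> * B powr (1 - \<theta>)"
  have young: "F x powr \<theta> * G x powr (1 - \<theta>) \<le> ?K * (\<theta> / A) * F x + ?K * ((1 - \<theta>) / B) * G x" for x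
  proof (cases "F x = 0 \<or> G x = 0")
    case True
    then show ?thesis
      using pos \<theta> F[of x] G[of x] by auto
  next
    case False
    then have "0 < F x / A" "0 < G x / B"
      using F[of x] G[of x] pos by auto
    then have "(F x / A) powr \<theta> * (G x / B) powr (1 - \<theta>) \<le> \<theta> * (F x / A) + (1 - \<theta>) * (G x / B)"
      using \<theta> by (intro Youngs_inequality_0) auto
    then have "?K * ((F x / A) powr \<theta> * (G x / B) powr (1 - \<theta>)) \<le> ?K * (\<theta> * (F x / A) + (1 - \<theta>) * (G x / B))"
      by (rule mult_left_mono) simp
    moreover have "?K * ((F x / A) powr \<theta> * (G x / B) powr (1 - \<theta>)) = F x powr \<theta> * G x powr (1 - \<theta>)"
      using pos F[of x] G[of x] by (simp add: powr_divide)
    ultimately show ?thesis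
      by (simp add: algebra_simps)
  qed
  \<comment> \<open>The coefficients of \<open>F\<close> and \<open>G\<close> in
    \<open>young\<close>; the weights sum to 1, so \<open>u * A + v * B = ?K\<close>.\<close>
  define u v where "u = ?K * (\<theta> / A)" and "v = ?K * ((1 - \<theta>) / B)"
  have uv: "0 \<le> u" "0 \<le> v"
    using pos \<theta> by (auto simp: u_def v_def)
  have "(\<integral>\<^sup>+ x. ennreal (F x powr \<theta> * G x powr (1 - \<theta>)) \<partial>M)
      \<le> (\<integral>\<^sup>+ x. ennreal u * ennreal (F x) + ennreal v * ennreal (G x) \<partial>M)"
  proof (rule nn_integral_mono)
    fix x
    have "ennreal (F x powr \<theta> * G x powr (1 - \<theta>)) \<le> ennreal (u * F x + v * G x)"
      unfolding u_def v_def by (rule ennreal_leI) (rule young)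
    also have "\<dots> = ennreal u * ennreal (F x) + ennreal v * ennreal (G x)"
      using uv F[of x] G[of x] by (simp add: ennreal_mult)
    finally show "ennreal (F x powr \<theta> * G x powr (1 - \<theta>)) \<le> ennreal u * ennreal (F x) + ennreal v * ennreal (G x)" .
  qed
  also have "\<dots> = ennreal u * (\<integral>\<^sup>+ x. ennreal (F x) \<partial>M) + ennreal v * (\<integral>\<^sup>+ x. ennreal (G x) \<partial>M)"
    by (simp add: nn_integral_add nn_integral_cmult)
  also have "\<dots> \<le> ennreal u * ennreal A + ennreal v * ennreal B"
    using A B by (intro add_mono mult_left_mono) auto
  also have "\<dots> = ennreal (u * A + v * B)"
    using pos uv by (simp add: ennreal_mult)
  also have "u * A + v * B = ?K"
    using pos by (simp add: u_def v_def field_simps)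
  finally show ?thesis .
qed

section \<open>The maximal commutator of a Lipschitz function\<close>

lemma powr_of_power: "0 < s \<Longrightarrow> (s ^ n) powr a = s powr (real n * a)"
  by (simp add: powr_powr flip: powr_realpow)

text \<open>The last identity is \<open>1 / q = 1 / p - \<beta> / n\<close> multiplied by
  \<open>p\<close>. Positivity of \<theta> comes from \<beta> < 1 and a dimension of at least
  1.\<close>

lemma exponent_pairs_BE:
  fixes p q :: "real ^ 'n \<Rightarrow> real"
  assumes "(p, q) \<in> exponent_pairs_B \<beta>" "\<beta> < 1"
  obtains \<theta> where "\<theta> = 1 - \<beta> / real CARD('n)" "0 < \<theta>" "\<theta> < 1"
    "variable_exponent p" "variable_exponent q" "variable_exponent (\<lambda>x. \<theta> * q x)"
    "bounded_operator maximal_function (\<lambda>x. \<theta> * q x) (\<lambda>x. \<theta> * q x)"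
    "\<And>x. p x / q x + p x * (1 - \<theta>) = 1"
proof (rule that[of "1 - \<beta> / real CARD('n)"])
  let ?n = "real CARD('n)"
  have n: "1 \<le> ?n"
    using zero_less_card_finite[where 'a = 'n] by linarith
  have \<beta>: "0 < \<beta>"
    using assms by (simp add: exponent_pairs_B_def)
  then have \<beta>n: "\<beta> < ?n"
    using n assms(2) by linarith
  show "0 < 1 - \<beta> / ?n" "1 - \<beta> / ?n < 1"
    using \<beta> \<beta>n by (auto simp: field_simps)
  show pq: "variable_exponent p" "variable_exponent q"
    using assms by (auto simp: exponent_pairs_B_def)
  have "(\<lambda>x. q x * (?n - \<beta>) / ?n) = (\<lambda>x. (1 - \<beta> / ?n) * q x)"
    using n by (auto simp: field_simps)
  then have "(\<lambda>x. (1 - \<beta> / ?n) * q x) \<in> exponents_B"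
    using assms by (simp add: exponent_pairs_B_def)
  then show "variable_exponent (\<lambda>x. (1 - \<beta> / ?n) * q x)"
    "bounded_operator maximal_function (\<lambda>x. (1 - \<beta> / ?n) * q x) (\<lambda>x. (1 - \<beta> / ?n) * q x)"
    by (auto simp: exponents_B_def exponents_P_def)
  show "p x / q x + p x * (1 - (1 - \<beta> / ?n)) = 1" for x
  proof -
    have "1 / q x = 1 / p x - \<beta> / ?n"
      using assms by (simp add: exponent_pairs_B_def)
    moreover have "p x \<noteq> 0"
      using variable_exponent_ge1[OF pq(1), of x] by simp
    moreover have "p x / q x = p x * (1 / q x)"
      by simp
    ultimately show ?thesis
      by (simp add: right_diff_distrib)
  qed
qed simp

lemma cube_average_le_maximal_function:
  fixes f :: "real ^ 'n \<Rightarrow> real"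
  assumes s: "0 < s" and x: "x \<in> cube a s" and le: "maximal_function f x \<le> ennreal A" "0 \<le> A"
  shows "(\<integral>\<^sup>+ y \<in> cube a s. ennreal \<bar>f y\<bar> \<partial>lebesgue) \<le> ennreal (A * s ^ CARD('n))"
proof -
  let ?I = "\<integral>\<^sup>+ y \<in> cube a s. ennreal \<bar>f y\<bar> \<partial>lebesgue"
  have "?I / emeasure lebesgue (cube a s) \<le> maximal_function f x"
    unfolding maximal_function_def using s x by (intro SUP_upper) auto
  then have "?I / ennreal (s ^ CARD('n)) \<le> ennreal A"
    using le s by (simp add: emeasure_cube)
  then have "?I / ennreal (s ^ CARD('n)) * ennreal (s ^ CARD('n)) \<le> ennreal A * ennreal (s ^ CARD('n))"
    by (rule mult_right_mono) simp
  then show ?thesis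
    using s le by (simp add: ennreal_divide_times ennreal_mult)
qed

text \<open>
  \<open>F = (F powr (p / (\<theta> * q))) powr \<theta> * (F powr p) powr (1 - \<theta>)\<close>, so Hoelder's inequality
  bounds fractional averages of \<open>F\<close> by a power of the maximal function of \<open>F powr (p / (\<theta> * q))\<close>.
\<close>

lemma nn_integral_cube_le:
  fixes F :: "real ^ 'n \<Rightarrow> real"
  assumes [measurable]: "F \<in> borel_measurable lebesgue" and F: "\<And>y. 0 \<le> F y"
    and p: "variable_exponent p" and q: "variable_exponent q" and \<theta>: "0 < \<theta>" "\<theta> < 1"
    and pq: "\<And>y. p y / q y + p y * (1 - \<theta>) = 1"
    and m: "modular p F \<le> ennreal m" "0 \<le> m"
    and A: "maximal_function (\<lambda>y. F y powr (p y / (\<theta> * q y))) x \<le> ennreal A" "0 \<le> A"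
    and s: "0 < s" "x \<in> cube a s"
  shows "(\<integral>\<^sup>+ y \<in> cube a s. ennreal (F y) \<partial>lebesgue) \<le> ennreal ((A * s ^ CARD('n)) powr \<theta> * m powr (1 - \<theta>))"
proof -
  note [measurable] = variable_exponent_measurable[OF p] variable_exponent_measurable[OF q]
  let ?G = "\<lambda>y. F y powr (p y / (\<theta> * q y)) * indicator (cube a s) y"
  have "(\<integral>\<^sup>+ y. ennreal (?G y) \<partial>lebesgue)
      = (\<integral>\<^sup>+ y \<in> cube a s. ennreal \<bar>F y powr (p y / (\<theta> * q y))\<bar> \<partial>lebesgue)"
    by (intro nn_integral_cong) (auto simp: indicator_def)
  also have "\<dots> \<le> ennreal (A * s ^ CARD('n))"
    by (rule cube_average_le_maximal_function) fact+
  finally have G: "(\<integral>\<^sup>+ y. ennreal (?G y) \<partial>lebesgue) \<le> ennreal (A * s ^ CARD('n))" .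
  have Fp: "(\<integral>\<^sup>+ y. ennreal (F y powr p y) \<partial>lebesgue) \<le> ennreal m"
    using m F by (simp add: modular_def)
  have eq: "?G y powr \<theta> * (F y powr p y) powr (1 - \<theta>) = F y * indicator (cube a s) y" for y
  proof (cases "F y = 0 \<or> y \<notin> cube a s")
    case False
    have "p y / (\<theta> * q y) * \<theta> + p y * (1 - \<theta>) = 1"
      using pq[of y] \<theta> by (simp add: field_simps)
    then show ?thesis
      using False F[of y] by (simp add: powr_powr flip: powr_add)
  qed (use \<theta> in \<open>auto simp: indicator_def\<close>)
  have "(\<integral>\<^sup>+ y \<in> cube a s. ennreal (F y) \<partial>lebesgue)
      = (\<integral>\<^sup>+ y. ennreal (?G y powr \<theta> * (F y powr p y) powr (1 - \<theta>)) \<partial>lebesgue)"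
    unfolding eq by (intro nn_integral_cong) (auto simp: indicator_def)
  also have "\<dots> \<le> ennreal ((A * s ^ CARD('n)) powr \<theta> * m powr (1 - \<theta>))"
    by (rule nn_integral_Holder) (use G Fp A m s \<theta> in auto)
  finally show ?thesis .
qed

text \<open>On a cube of side \<open>s\<close> through \<open>x\<close> the Lipschitz factor is at
  most \<open>L * (n * s) powr \<beta>\<close>. By \<open>\<beta> + n * \<theta> = n\<close>, it
  combines with \<open>(s ^ n) powr \<theta>\<close> from Hoelder's inequality to the volume of the
  cube, so the averages are bounded independently of \<open>s\<close>. Only points with
  \<open>b x = g x\<close> are treated because \<open>b x\<close> itself occurs in the
  commutator.\<close>

lemma maximal_commutator_le:
  fixes b f g :: "real ^ 'n \<Rightarrow> real"
  assumes f: "f \<in> borel_measurable lebesgue"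
    and p: "variable_exponent p" and q: "variable_exponent q"
    and \<theta>_eq: "\<theta> = 1 - \<beta> / real CARD('n)" and \<theta>: "0 < \<theta>" "\<theta> < 1"
    and pq: "\<And>y. p y / q y + p y * (1 - \<theta>) = 1"
    and bg: "AE y in lebesgue. b y = g y" "b x = g x"
    and g: "\<And>y. \<bar>g x - g y\<bar> \<le> L * norm (x - y) powr \<beta>" and L: "0 \<le> L" and \<beta>: "0 < \<beta>"
    and t: "0 < t" and m: "modular p (\<lambda>y. \<bar>f y\<bar> / t) \<le> ennreal m" "0 \<le> m"
    and A: "maximal_function (\<lambda>y. (\<bar>f y\<bar> / t) powr (p y / (\<theta> * q y))) x \<le> ennreal A" "0 \<le> A"
  shows "maximal_commutator b f x \<le> ennreal (L * real CARD('n) powr \<beta> * t * (A powr \<theta> * m powr (1 - \<theta>)))"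
  unfolding maximal_commutator_def
proof (rule SUP_least, clarify)
  note [measurable] = f
  let ?n = "real CARD('n)"
  fix Q assume "Q \<in> cubes" "x \<in> Q"
  then obtain a s where Q: "Q = cube a s" and s: "0 < s" and x: "x \<in> cube a s"
    by (auto elim: cubesE)
  have F: "(\<integral>\<^sup>+ y \<in> cube a s. ennreal (\<bar>f y\<bar> / t) \<partial>lebesgue) \<le> ennreal ((A * s ^ CARD('n)) powr \<theta> * m powr (1 - \<theta>))"
    using f t by (intro nn_integral_cube_le[OF _ _ p q \<theta> pq m A s x]) auto
  let ?c = "L * (?n * s) powr \<beta> * t"
  have c: "0 \<le> ?c"
    using L t by simp
  have "(\<integral>\<^sup>+ y \<in> Q. ennreal (\<bar>b x - b y\<bar> * \<bar>f y\<bar>) \<partial>lebesgue)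
      \<le> (\<integral>\<^sup>+ y. ennreal ?c * (ennreal (\<bar>f y\<bar> / t) * indicator (cube a s) y) \<partial>lebesgue)"
  proof (rule nn_integral_mono_AE)
    show "AE y in lebesgue. ennreal (\<bar>b x - b y\<bar> * \<bar>f y\<bar>) * indicator Q y
        \<le> ennreal ?c * (ennreal (\<bar>f y\<bar> / t) * indicator (cube a s) y)"
      using bg(1)
    proof eventually_elim
      case (elim y)
      show ?case
      proof (cases "y \<in> cube a s")
        case True
        have "\<bar>b x - b y\<bar> \<le> L * norm (x - y) powr \<beta>"
          using g[of y] elim bg(2) by simp
        also have "\<dots> \<le> L * (?n * s) powr \<beta>"
          using norm_diff_cube[OF x True] L \<beta> by (intro mult_left_mono powr_mono2) auto
        finally have "\<bar>b x - b y\<bar> * \<bar>f y\<bar> \<le> L * (?n * s) powr \<beta> * \<bar>f y\<bar>"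
          by (rule mult_right_mono) simp
        also have "\<dots> = ?c * (\<bar>f y\<bar> / t)"
          using t by simp
        finally have "ennreal (\<bar>b x - b y\<bar> * \<bar>f y\<bar>) \<le> ennreal (?c * (\<bar>f y\<bar> / t))"
          by (rule ennreal_leI)
        also have "\<dots> = ennreal ?c * ennreal (\<bar>f y\<bar> / t)"
          using c t by (intro ennreal_mult) auto
        finally show ?thesis
          using True by (simp add: Q)
      qed (simp add: Q)
    qed
  qed
  also have "\<dots> = ennreal ?c * (\<integral>\<^sup>+ y \<in> cube a s. ennreal (\<bar>f y\<bar> / t) \<partial>lebesgue)"
    by (intro nn_integral_cmult) measurable
  also have "\<dots> \<le> ennreal ?c * ennreal ((A * s ^ CARD('n)) powr \<theta> * m powr (1 - \<theta>))"
    using F by (rule mult_left_mono) simp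
  also have "\<dots> = ennreal (?c * ((A * s ^ CARD('n)) powr \<theta> * m powr (1 - \<theta>)))"
    using c by (intro ennreal_mult[symmetric]) auto
  also have "?c * ((A * s ^ CARD('n)) powr \<theta> * m powr (1 - \<theta>))
      = L * ?n powr \<beta> * t * (A powr \<theta> * m powr (1 - \<theta>)) * s ^ CARD('n)"
  proof -
    have "s powr \<beta> * (s ^ CARD('n)) powr \<theta> = s powr (\<beta> + ?n * \<theta>)"
      using s by (simp add: powr_of_power powr_add)
    also have "\<beta> + ?n * \<theta> = ?n"
      by (simp add: \<theta>_eq right_diff_distrib)
    also have "s powr ?n = s ^ CARD('n)"
      using s by (rule powr_realpow)
    finally have "s powr \<beta> * (s ^ CARD('n)) powr \<theta> = s ^ CARD('n)" .
    moreover have "?c * ((A * s ^ CARD('n)) powr \<theta> * m powr (1 - \<theta>))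
        = L * ?n powr \<beta> * t * (A powr \<theta> * m powr (1 - \<theta>)) * (s powr \<beta> * (s ^ CARD('n)) powr \<theta>)"
      using s A by (simp add: powr_mult)
    ultimately show ?thesis by simp
  qed
  finally show "(\<integral>\<^sup>+ y \<in> Q. ennreal (\<bar>b x - b y\<bar> * \<bar>f y\<bar>) \<partial>lebesgue) / emeasure lebesgue Q
      \<le> ennreal (L * ?n powr \<beta> * t * (A powr \<theta> * m powr (1 - \<theta>)))"
    using s L t A m by (intro divide_le_posI_ennreal) (auto simp: Q emeasure_cube ennreal_mult' mult.commute)
qed

lemma lipschitz_spaceE:
  assumes "b \<in> lipschitz_space \<beta>"
  obtains g L where "AE x in lebesgue. b x = g x" "0 \<le> L" "\<And>x y. \<bar>g x - g y\<bar> \<le> L * norm (x - y) powr \<beta>"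
proof -
  obtain g C where g: "AE x in lebesgue. b x = g x" "\<And>x y. \<bar>g x - g y\<bar> \<le> C * norm (x - y) powr \<beta>"
    using assms by (auto simp: lipschitz_space_def)
  have "\<bar>g x - g y\<bar> \<le> \<bar>C\<bar> * norm (x - y) powr \<beta>" for x y
    by (rule order_trans[OF g(2)]) (intro mult_right_mono, auto)
  with g(1) show ?thesis
    by (intro that[of g "\<bar>C\<bar>"]) auto
qed

lemma bounded_operator_maximal_commutator:
  fixes b :: "real ^ 'n \<Rightarrow> real"
  assumes b: "b \<in> lipschitz_space \<beta>" and meas_b: "b \<in> borel_measurable lebesgue"
    and \<beta>: "0 < \<beta>" "\<beta> < 1" and pair: "(p, q) \<in> exponent_pairs_B \<beta>"
  shows "bounded_operator (maximal_commutator b) p q"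
proof -
  obtain \<theta> where \<theta>: "\<theta> = 1 - \<beta> / real CARD('n)" "0 < \<theta>" "\<theta> < 1"
    and p: "variable_exponent p" and q: "variable_exponent q" and r: "variable_exponent (\<lambda>x. \<theta> * q x)"
    and M: "bounded_operator maximal_function (\<lambda>x. \<theta> * q x) (\<lambda>x. \<theta> * q x)"
    and pq: "\<And>x. p x / q x + p x * (1 - \<theta>) = 1"
    using exponent_pairs_BE[OF pair \<beta>(2)] by metis
  note [measurable] = variable_exponent_measurable[OF p] variable_exponent_measurable[OF q]
  obtain C where C: "0 < C"
    "\<And>f. f \<in> Lvar (\<lambda>x. \<theta> * q x) \<Longrightarrow> AE x in lebesgue. maximal_function f x < \<infinity>"
    "\<And>f t. f \<in> borel_measurable lebesgue \<Longrightarrow> 0 < t \<Longrightarrow> modular (\<lambda>x. \<theta> * q x) (\<lambda>x. \<bar>f x\<bar> / t) \<le> 1 \<Longrightarrow>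
       modular (\<lambda>x. \<theta> * q x) (\<lambda>x. \<bar>enn2real (maximal_function f x)\<bar> / (C * t)) \<le> 1"
    using bounded_operator_modularD[OF M r] by metis
  obtain g L where g: "AE x in lebesgue. b x = g x" "0 \<le> L" "\<And>x y. \<bar>g x - g y\<bar> \<le> L * norm (x - y) powr \<beta>"
    using lipschitz_spaceE[OF b] by metis
  \<comment> \<open>The division by \<open>t\<close> stands inside the power since the exponent
    depends on \<open>y\<close>. Thus the \<open>\<theta> * q\<close>-modular of
    \<open>G f t\<close> equals the \<open>p\<close>-modular of \<open>f\<close> at scale
    \<open>t\<close>.\<close>
  define G where "G f t = (\<lambda>y. (\<bar>f y\<bar> / t) powr (p y / (\<theta> * q y)))" for f and t :: real
  define K where "K = L * real CARD('n) powr \<beta>"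
  have K: "0 \<le> K"
    using g by (simp add: K_def)
  have G_meas [measurable]: "G f t \<in> borel_measurable lebesgue" if [measurable]: "f \<in> borel_measurable lebesgue" for f t
    unfolding G_def by measurable
  have G_modular: "modular (\<lambda>x. \<theta> * q x) (\<lambda>x. \<bar>G f t x\<bar> / 1) = modular p (\<lambda>x. \<bar>f x\<bar> / t)" if "0 < t" for f t
  proof -
    have "\<theta> * q x \<noteq> 0" for x
      using variable_exponent_ge1[OF q, of x] \<theta> by auto
    then show ?thesis
      using that by (simp add: modular_def G_def powr_powr)
  qed
  have G_Lvar: "G f t \<in> Lvar (\<lambda>x. \<theta> * q x)"
    if "f \<in> borel_measurable lebesgue" "0 < t" "modular p (\<lambda>x. \<bar>f x\<bar> / t) < \<infinity>" for f t
    using that G_modular[of t f] unfolding Lvar_def by (auto intro: exI[of _ 1])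
  \<comment> \<open>Used twice: with any finite \<open>m\<close> it shows that the commutator is
    finite almost everywhere, and with \<open>m = 1\<close> it gives the norm bound.\<close>
  have bound: "AE x in lebesgue. maximal_commutator b f x
      \<le> ennreal (K * t * (enn2real (maximal_function (G f t) x) powr \<theta> * m powr (1 - \<theta>)))"
    if f: "f \<in> borel_measurable lebesgue" and t: "0 < t" and m: "modular p (\<lambda>x. \<bar>f x\<bar> / t) \<le> ennreal m" "0 \<le> m" for f t m
  proof -
    have "modular p (\<lambda>x. \<bar>f x\<bar> / t) < \<infinity>"
      using m(1) by (rule le_less_trans) simp
    then have "AE x in lebesgue. maximal_function (G f t) x < \<infinity>"
      by (intro C G_Lvar f t)
    with g(1) show ?thesis
    proof eventually_elim
      case (elim x)
      have "maximal_function (\<lambda>y. (\<bar>f y\<bar> / t) powr (p y / (\<theta> * q y))) x \<le> ennreal (enn2real (maximal_function (G f t) x))"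
        using elim by (simp add: G_def)
      then show ?case
        unfolding K_def using maximal_commutator_le[OF f p q \<theta> pq g(1) elim(1) g(3) g(2) \<beta>(1) t m] by simp
    qed
  qed
  show ?thesis
  \<comment> \<open>The bound \<open>C\<close> for the maximal function is raised to \<theta> along
    with that function; \<open>K + 1\<close> is positive even when \<open>K = 0\<close>.\<close>
  proof (rule bounded_operatorI[OF p, of "(K + 1) * C powr \<theta>"])
    show "0 < (K + 1) * C powr \<theta>"
      using K C by simp
    show "maximal_commutator b f \<in> borel_measurable lebesgue" if "f \<in> borel_measurable lebesgue" for f
      using that meas_b by (rule borel_measurable_maximal_commutator)
    show "AE x in lebesgue. maximal_commutator b f x < \<infinity>" if Lp: "f \<in> Lvar p" for f
    proof -
      obtain t where f: "f \<in> borel_measurable lebesgue" and t: "0 < t" "modular p (\<lambda>x. \<bar>f x\<bar> / t) < \<infinity>"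
        using Lp unfolding Lvar_def by blast
      then obtain m where m: "modular p (\<lambda>x. \<bar>f x\<bar> / t) = ennreal m" "0 \<le> m"
        by (cases "modular p (\<lambda>x. \<bar>f x\<bar> / t)") auto
      have "AE x in lebesgue. maximal_commutator b f x
          \<le> ennreal (K * t * (enn2real (maximal_function (G f t) x) powr \<theta> * m powr (1 - \<theta>)))"
        using f t m by (intro bound) auto
      then show ?thesis
        by eventually_elim (auto intro: le_less_trans)
    qed
    show "modular q (\<lambda>x. \<bar>enn2real (maximal_commutator b f x)\<bar> / ((K + 1) * C powr \<theta> * t)) \<le> 1"
      if f: "f \<in> borel_measurable lebesgue" and t: "0 < t" and le: "modular p (\<lambda>x. \<bar>f x\<bar> / t) \<le> 1" for f t
    proof -
      let ?A = "\<lambda>x. enn2real (maximal_function (G f t) x)"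
      have "modular p (\<lambda>x. \<bar>f x\<bar> / t) \<le> ennreal 1"
        using le by simp
      then have "AE x in lebesgue. maximal_commutator b f x \<le> ennreal (K * t * (?A x powr \<theta> * 1 powr (1 - \<theta>)))"
        by (intro bound f t) auto
      then have "AE x in lebesgue. \<bar>\<bar>enn2real (maximal_commutator b f x)\<bar> / ((K + 1) * C powr \<theta> * t)\<bar> \<le> \<bar>(?A x / C) powr \<theta>\<bar>"
      proof eventually_elim
        case (elim x)
        have "enn2real (maximal_commutator b f x) \<le> K * t * ?A x powr \<theta>"
          using elim K t by (intro enn2real_leI) auto
        also have "\<dots> \<le> (K + 1) * t * ?A x powr \<theta>"
          using K t by (intro mult_right_mono) auto
        finally have "enn2real (maximal_commutator b f x) / ((K + 1) * t) \<le> ?A x powr \<theta>"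
          using K t by (subst pos_divide_le_eq) (auto simp: mult.commute)
        then have "enn2real (maximal_commutator b f x) / ((K + 1) * t) / C powr \<theta> \<le> ?A x powr \<theta> / C powr \<theta>"
          by (rule divide_right_mono) simp
        then show ?case
          using K t C by (simp add: powr_divide mult.commute mult.left_commute)
      qed
      then have "modular q (\<lambda>x. \<bar>enn2real (maximal_commutator b f x)\<bar> / ((K + 1) * C powr \<theta> * t))
          \<le> modular q (\<lambda>x. (?A x / C) powr \<theta>)"
        by (rule modular_mono_AE[OF q])
      \<comment> \<open>The power \<theta> moves into the exponent and turns \<open>q\<close> into
        \<open>\<theta> * q\<close>, where the bound for the maximal function is available.\<close>
      also have "\<dots> = modular (\<lambda>x. \<theta> * q x) (\<lambda>x. \<bar>?A x\<bar> / (C * 1))"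
        using C by (simp add: modular_def powr_powr)
      also have "\<dots> \<le> 1"
      proof (rule C)
        show "modular (\<lambda>x. \<theta> * q x) (\<lambda>x. \<bar>G f t x\<bar> / 1) \<le> 1"
          unfolding G_modular[OF t] by (rule le)
      qed (use f in auto)
      finally show ?thesis .
    qed
  qed
qed

section \<open>Mean oscillation\<close>

text \<open>The truncations of \<open>b\<close> to growing balls are integrable and eventually
  constant at each point.\<close>

lemma locally_integrable_measurable:
  assumes "locally_integrable b"
  shows "b \<in> borel_measurable lebesgue"
proof (rule borel_measurable_LIMSEQ_real)
  show "(\<lambda>x. indicator (cball 0 (real k)) x *\<^sub>R b x) \<in> borel_measurable lebesgue" for k
    using assms compact_cball[of 0 "real k"] unfolding locally_integrable_def set_integrable_def
    by (blast intro: borel_measurable_integrable)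
  fix x :: "real ^ 'a"
  obtain k0 where k0: "norm x \<le> real k0"
    using real_arch_simple by blast
  have "\<forall>\<^sub>F k in sequentially. indicator (cball 0 (real k)) x *\<^sub>R b x = b x"
    using eventually_ge_at_top[of k0]
    by eventually_elim (use k0 in \<open>auto simp: indicator_def\<close>)
  then show "(\<lambda>k. indicator (cball 0 (real k)) x *\<^sub>R b x) \<longlonglongrightarrow> b x"
    by (rule tendsto_eventually)
qed

lemma locally_integrable_cube: "locally_integrable b \<Longrightarrow> set_integrable lebesgue (cube a s) b"
  by (simp add: locally_integrable_def compact_cube)

text \<open>The triangle inequality for integrals. Taking \<open>c = b x\<close> bounds
  \<open>b\<close> minus its average at \<open>x\<close>; taking for \<open>c\<close> the average
  over a larger cube compares two averages.\<close>

lemma abs_diff_cube_average_le: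
  fixes b :: "real ^ 'n \<Rightarrow> real"
  assumes b: "set_integrable lebesgue (cube a s) b" and s: "0 < s"
  shows "ennreal (\<bar>c - cube_average b (cube a s)\<bar> * s ^ CARD('n)) \<le> (\<integral>\<^sup>+ y \<in> cube a s. ennreal \<bar>c - b y\<bar> \<partial>lebesgue)"
proof -
  have c: "set_integrable lebesgue (cube a s) (\<lambda>y. c)"
    using s by (auto simp: set_integrable_def emeasure_cube intro!: integrable_real_indicator)
  have "(LINT y:cube a s|lebesgue. c - b y) = (LINT y:cube a s|lebesgue. c) - (LINT y:cube a s|lebesgue. b y)"
    using c b by (rule set_integral_diff)
  also have "(LINT y:cube a s|lebesgue. c) = s ^ CARD('n) * c"
    using s by (simp add: set_lebesgue_integral_def measure_cube)
  also have "s ^ CARD('n) * c - (LINT y:cube a s|lebesgue. b y) = (c - cube_average b (cube a s)) * s ^ CARD('n)"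
    using s by (simp add: cube_average_def measure_cube field_simps)
  finally have "\<bar>c - cube_average b (cube a s)\<bar> * s ^ CARD('n) = norm (LINT y:cube a s|lebesgue. c - b y)"
    using s by (simp add: abs_mult)
  moreover have "ennreal (norm (LINT y:cube a s|lebesgue. c - b y))
      \<le> (\<integral>\<^sup>+ y. norm (indicator (cube a s) y *\<^sub>R (c - b y)) \<partial>lebesgue)"
    using set_integral_diff(1)[OF c b] unfolding set_lebesgue_integral_def set_integrable_def
    by (rule integral_norm_bound_ennreal)
  moreover have "\<dots> = (\<integral>\<^sup>+ y \<in> cube a s. ennreal \<bar>c - b y\<bar> \<partial>lebesgue)"
    by (intro nn_integral_cong) (auto simp: indicator_def)
  ultimately show ?thesis by simp
qed

lemma measure_cube_powr:
  fixes a :: "real ^ 'n"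
  assumes "0 < s"
  shows "measure lebesgue (cube a s) powr (\<beta> / real CARD('n)) = s powr \<beta>"
  using assms by (simp add: measure_cube powr_of_power)

lemma oscillation_sup_leI:
  fixes b :: "real ^ 'n \<Rightarrow> real"
  assumes K: "0 \<le> K" and le: "\<And>a s. 0 < s \<Longrightarrow>
      Lvar_norm q (\<lambda>x. (b x - cube_average b (cube a s)) * indicator (cube a s) x)
        \<le> ennreal (K * s powr \<beta>) * Lvar_norm q (indicator (cube a s))"
  shows "oscillation_sup \<beta> q b \<le> ennreal K"
  unfolding oscillation_sup_def
proof (rule SUP_least)
  fix Q :: "(real ^ 'n) set" assume "Q \<in> cubes"
  then obtain a s where Q: "Q = cube a s" and s: "0 < s"
    by (rule cubesE)
  let ?X = "Lvar_norm q (\<lambda>x. (b x - cube_average b Q) * indicator Q x)" and ?Y = "Lvar_norm q (indicator Q)"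
  have XY: "?X \<le> ennreal (K * s powr \<beta>) * ?Y"
    unfolding Q using s by (rule le)
  have "?X / ?Y \<le> ennreal (K * s powr \<beta>)"
  \<comment> \<open>In the degenerate cases the quotient is 0: if \<open>?Y = 0\<close> then
    \<open>?X = 0\<close> as well, and division by \<open>top\<close> gives 0.\<close>
  proof (cases "?Y = 0 \<or> ?Y = top")
    case False
    have "?X / ?Y \<le> ennreal (K * s powr \<beta>) * ?Y / ?Y"
      using XY by (rule divide_right_mono_ennreal)
    also have "\<dots> = ennreal (K * s powr \<beta>)"
      using False by (simp add: ennreal_times_divide[symmetric] top.not_eq_extremum)
    finally show ?thesis .
  qed (use XY in auto)
  then have "ennreal (1 / s powr \<beta>) * (?X / ?Y) \<le> ennreal (1 / s powr \<beta>) * ennreal (K * s powr \<beta>)"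
    by (rule mult_left_mono) simp
  also have "\<dots> = ennreal K"
    using s K by (simp add: ennreal_mult[symmetric])
  finally show "ennreal (1 / measure lebesgue Q powr (\<beta> / real CARD('n))) * (?X / ?Y) \<le> ennreal K"
    using s by (simp add: Q measure_cube_powr)
qed

lemma Lvar_norm_cube:
  assumes "variable_exponent q" "0 < s"
  shows "0 < Lvar_norm q (indicator (cube a s))" "Lvar_norm q (indicator (cube a s)) < top"
  using assms by (auto intro!: Lvar_norm_indicator emeasure_cube)

lemma oscillation_supD:
  fixes b :: "real ^ 'n \<Rightarrow> real"
  assumes fin: "oscillation_sup \<beta> q b < \<infinity>" and q: "variable_exponent q"
  obtains K where "0 < K" "\<And>a s. 0 < s \<Longrightarrow>
      Lvar_norm q (\<lambda>x. (b x - cube_average b (cube a s)) * indicator (cube a s) x)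
        \<le> ennreal (K * s powr \<beta>) * Lvar_norm q (indicator (cube a s))"
proof -
  obtain K where K: "oscillation_sup \<beta> q b = ennreal K" "0 \<le> K"
    using fin by (cases "oscillation_sup \<beta> q b") auto
  show ?thesis
  \<comment> \<open>A positive constant is required later, where \<open>K * s powr \<beta>\<close>
    serves as a scale, and the supremum itself may be 0.\<close>
  proof (rule that[of "K + 1"])
    fix a :: "real ^ 'n" and s :: real assume s: "0 < s"
    let ?Q = "cube a s"
    let ?X = "Lvar_norm q (\<lambda>x. (b x - cube_average b ?Q) * indicator ?Q x)" and ?Y = "Lvar_norm q (indicator ?Q)"
    have Y: "0 < ?Y" "?Y < top"
      using q s by (rule Lvar_norm_cube)+
    have "ennreal (1 / measure lebesgue ?Q powr (\<beta> / real CARD('n))) * (?X / ?Y) \<le> oscillation_sup \<beta> q b"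
      unfolding oscillation_sup_def using s by (intro SUP_upper) simp
    then have "ennreal (1 / s powr \<beta>) * (?X / ?Y) \<le> ennreal K"
      using s K by (simp add: measure_cube_powr)
    then have "ennreal (s powr \<beta>) * (ennreal (1 / s powr \<beta>) * (?X / ?Y)) \<le> ennreal (s powr \<beta>) * ennreal K"
      by (rule mult_left_mono) simp
    moreover have "ennreal (s powr \<beta>) * (ennreal (1 / s powr \<beta>) * (?X / ?Y)) = ?X / ?Y"
      using s by (simp add: mult.assoc[symmetric] ennreal_mult[symmetric])
    moreover have "ennreal (s powr \<beta>) * ennreal K \<le> ennreal ((K + 1) * s powr \<beta>)"
      using K by (simp add: ennreal_mult[symmetric] algebra_simps)
    ultimately have "?X / ?Y \<le> ennreal ((K + 1) * s powr \<beta>)"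
      by simp
    then have "?X / ?Y * ?Y \<le> ennreal ((K + 1) * s powr \<beta>) * ?Y"
      by (rule mult_right_mono) simp
    then show "?X \<le> ennreal ((K + 1) * s powr \<beta>) * ?Y"
      using Y by (simp add: ennreal_divide_times)
  qed (use K in simp)
qed

section \<open>Finiteness of the oscillation for Lipschitz functions and for bounded
  commutators\<close>

lemma borel_measurable_centred:
  fixes b :: "real ^ 'n \<Rightarrow> real"
  assumes [measurable]: "b \<in> borel_measurable lebesgue"
  shows "(\<lambda>x. (b x - c) * indicator (cube a s) x) \<in> borel_measurable lebesgue"
  by measurable

text \<open>The bound is pointwise: almost everywhere on a cube of side \<open>s\<close>,
  \<open>b\<close> differs from its average by at most \<open>K * s powr \<beta>\<close>.
  Monotonicity of the norm then handles every exponent \<open>q\<close>.\<close>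

lemma oscillation_sup_lipschitz:
  fixes b :: "real ^ 'n \<Rightarrow> real"
  assumes b: "b \<in> lipschitz_space \<beta>" "locally_integrable b" and \<beta>: "0 < \<beta>" and q: "variable_exponent q"
  shows "oscillation_sup \<beta> q b < \<infinity>"
proof -
  let ?n = "real CARD('n)"
  obtain g L where g: "AE x in lebesgue. b x = g x" "0 \<le> L" "\<And>x y. \<bar>g x - g y\<bar> \<le> L * norm (x - y) powr \<beta>"
    using lipschitz_spaceE[OF b(1)] by metis
  note meas = locally_integrable_measurable[OF b(2)]
  \<comment> \<open>The factor \<open>?n powr \<beta>\<close> comes from
    \<open>norm_diff_cube\<close>; adding 1 keeps \<open>K\<close> positive when
    \<open>L = 0\<close>.\<close>
  define K where "K = L * ?n powr \<beta> + 1"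
  have K: "0 < K"
    using g(2) by (simp add: K_def add_nonneg_pos)
  have "oscillation_sup \<beta> q b \<le> ennreal K"
  proof (rule oscillation_sup_leI)
    fix a :: "real ^ 'n" and s :: real assume s: "0 < s"
    let ?Q = "cube a s"
    show "Lvar_norm q (\<lambda>x. (b x - cube_average b ?Q) * indicator ?Q x) \<le> ennreal (K * s powr \<beta>) * Lvar_norm q (indicator ?Q)"
    proof (rule Lvar_norm_mono_AE[OF q borel_measurable_centred[OF meas]])
      show "0 < K * s powr \<beta>"
        using K s by simp
      show "AE x in lebesgue. \<bar>(b x - cube_average b ?Q) * indicator ?Q x\<bar> \<le> K * s powr \<beta> * \<bar>indicator ?Q x\<bar>"
        using g(1)
      proof eventually_elim
        case (elim x)
        show ?case
        proof (cases "x \<in> ?Q")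
          case x: True
          have "ennreal (\<bar>b x - cube_average b ?Q\<bar> * s ^ CARD('n)) \<le> (\<integral>\<^sup>+ y \<in> ?Q. ennreal \<bar>b x - b y\<bar> \<partial>lebesgue)"
            using locally_integrable_cube[OF b(2)] s by (rule abs_diff_cube_average_le)
          also have "\<dots> \<le> (\<integral>\<^sup>+ y \<in> ?Q. ennreal (K * s powr \<beta>) \<partial>lebesgue)"
          proof (rule nn_integral_mono_AE)
            show "AE y in lebesgue. ennreal \<bar>b x - b y\<bar> * indicator ?Q y \<le> ennreal (K * s powr \<beta>) * indicator ?Q y"
              using g(1)
            proof eventually_elim
              case (elim y)
              show ?case
              proof (cases "y \<in> ?Q")
                case True
                have "\<bar>b x - b y\<bar> \<le> L * norm (x - y) powr \<beta>"
                  using g(3)[of x y] elim \<open>b x = g x\<close> by simp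
                also have "\<dots> \<le> L * (?n * s) powr \<beta>"
                  using norm_diff_cube[OF x True] g(2) \<beta> by (intro mult_left_mono powr_mono2) auto
                also have "\<dots> \<le> K * s powr \<beta>"
                  using s by (simp add: K_def powr_mult algebra_simps)
                finally show ?thesis
                  using True by (simp add: ennreal_leI)
              qed simp
            qed
          qed
          also have "\<dots> = ennreal (K * s powr \<beta> * s ^ CARD('n))"
            using s K by (simp add: nn_integral_cmult_indicator emeasure_cube ennreal_mult[symmetric])
          finally have "\<bar>b x - cube_average b ?Q\<bar> * s ^ CARD('n) \<le> K * s powr \<beta> * s ^ CARD('n)"
            using s K by (subst (asm) ennreal_le_iff) auto
          then show ?thesis
            using s x by simp
        qed simp
      qed
    qed
  qed (use K in simp)
  then show ?thesis
    by (rule le_less_trans) simp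
qed

text \<open>
  Young's inequality with weights \<open>p / q\<close> and \<open>p (1 - \<theta>)\<close>, applied to \<open>(1 / t) powr q\<close> and \<open>s powr (- n)\<close>.
\<close>

lemma Lvar_norm_cube_exponents:
  fixes p q :: "real ^ 'n \<Rightarrow> real" and a :: "real ^ 'n"
  assumes p: "variable_exponent p" and q: "variable_exponent q"
    and \<theta>_eq: "\<theta> = 1 - \<beta> / real CARD('n)" and \<theta>: "0 < \<theta>" "\<theta> < 1"
    and pq: "\<And>x. p x / q x + p x * (1 - \<theta>) = 1" and s: "0 < s"
  shows "Lvar_norm p (indicator (cube a s)) \<le> ennreal (2 * s powr \<beta>) * Lvar_norm q (indicator (cube a s))"
proof (rule Lvar_norm_le_cmult[OF q])
  let ?Q = "cube a s"
  note [measurable] = variable_exponent_measurable[OF p] variable_exponent_measurable[OF q]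
  fix t :: real assume t: "0 < t" and le: "modular q (\<lambda>x. \<bar>indicator ?Q x\<bar> / t) \<le> 1"
  \<comment> \<open>Both terms of Young's inequality integrate to at most 1 over the cube. Since
    \<open>p\<close> is at least 1, the 2 in the scale contributes a factor of at most
    \<open>1 / 2\<close>, which brings their sum below 1.\<close>
  have pt: "(1 / (2 * s powr \<beta> * t)) powr p x \<le> (1 / 2) * (1 / t) powr q x + (1 / 2) * (1 / s ^ CARD('n))" for x
  proof -
    note p1 = variable_exponent_ge1[OF p, of x] and q1 = variable_exponent_ge1[OF q, of x]
    let ?u = "p x / q x" and ?v = "p x * (1 - \<theta>)"
    have u: "0 \<le> ?u" "?u \<le> 1" "0 \<le> ?v" "?v \<le> 1"
    proof -
      show u0: "0 \<le> ?u"
        using p1 q1 by simp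
      show v0: "0 \<le> ?v"
        using p1 \<theta> by simp
      show "?u \<le> 1" "?v \<le> 1"
        using u0 v0 pq[of x] by linarith+
    qed
    have "((1 / t) powr q x) powr ?u * (1 / s ^ CARD('n)) powr ?v \<le> ?u * (1 / t) powr q x + ?v * (1 / s ^ CARD('n))"
      using u pq[of x] t s by (intro Youngs_inequality_0) auto
    also have "\<dots> \<le> 1 * (1 / t) powr q x + 1 * (1 / s ^ CARD('n))"
      using u s by (intro add_mono mult_right_mono) auto
    also have "((1 / t) powr q x) powr ?u = (1 / t) powr p x"
      using q1 by (simp add: powr_powr)
    also have "(1 / s ^ CARD('n)) powr ?v = (1 / s powr \<beta>) powr p x"
    proof -
      have "real CARD('n) * ?v = \<beta> * p x"
        by (simp add: \<theta>_eq)
      then have "(s ^ CARD('n)) powr ?v = s powr (\<beta> * p x)"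
        by (simp only: powr_of_power[OF s])
      then show ?thesis
        using s by (simp add: powr_divide powr_powr)
    qed
    finally have Y: "(1 / t) powr p x * (1 / s powr \<beta>) powr p x \<le> (1 / t) powr q x + 1 / s ^ CARD('n)"
      by simp
    have "(1 / (2 * s powr \<beta> * t)) powr p x = (1 / 2) powr p x * ((1 / t) powr p x * (1 / s powr \<beta>) powr p x)"
      using s t by (simp add: powr_divide powr_mult)
    also have "\<dots> \<le> (1 / 2) powr 1 * ((1 / t) powr q x + 1 / s ^ CARD('n))"
      using Y p1 s by (intro mult_mono powr_mono') auto
    finally show ?thesis
      by (simp add: algebra_simps)
  qed
  have "modular p (\<lambda>x. \<bar>indicator ?Q x\<bar> / (2 * s powr \<beta> * t))
      \<le> (\<integral>\<^sup>+ x. ennreal (1 / 2) * (ennreal ((1 / t) powr q x) * indicator ?Q x)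
          + ennreal (1 / 2) * (ennreal (1 / s ^ CARD('n)) * indicator ?Q x) \<partial>lebesgue)"
    unfolding modular_indicator
  proof (rule nn_integral_mono)
    fix x
    have "ennreal ((1 / \<bar>2 * s powr \<beta> * t\<bar>) powr p x) \<le> ennreal ((1 / 2) * (1 / t) powr q x + (1 / 2) * (1 / s ^ CARD('n)))"
      using pt[of x] t s by (intro ennreal_leI) simp
    also have "\<dots> = ennreal (1 / 2) * ennreal ((1 / t) powr q x) + ennreal (1 / 2) * ennreal (1 / s ^ CARD('n))"
      using s by (simp only: ennreal_plus ennreal_mult mult_nonneg_nonneg zero_le_divide_1_iff zero_le_power less_imp_le powr_ge_zero zero_le_numeral)
    finally show "ennreal ((1 / \<bar>2 * s powr \<beta> * t\<bar>) powr p x) * indicator ?Q x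
        \<le> ennreal (1 / 2) * (ennreal ((1 / t) powr q x) * indicator ?Q x)
          + ennreal (1 / 2) * (ennreal (1 / s ^ CARD('n)) * indicator ?Q x)"
      by (cases "x \<in> ?Q") auto
  qed
  also have "\<dots> = ennreal (1 / 2) * (\<integral>\<^sup>+ x \<in> ?Q. ennreal ((1 / t) powr q x) \<partial>lebesgue)
      + ennreal (1 / 2) * (\<integral>\<^sup>+ x \<in> ?Q. ennreal (1 / s ^ CARD('n)) \<partial>lebesgue)"
    by (simp add: nn_integral_add nn_integral_cmult del: ennreal_half)
  also have "(\<integral>\<^sup>+ x \<in> ?Q. ennreal ((1 / t) powr q x) \<partial>lebesgue) \<le> 1"
    using le[unfolded modular_indicator] t by simp
  also have "(\<integral>\<^sup>+ x \<in> ?Q. ennreal (1 / s ^ CARD('n)) \<partial>lebesgue) = 1"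
    using s by (simp add: nn_integral_cmult_indicator emeasure_cube ennreal_mult[symmetric])
  also have "ennreal (1 / 2) * 1 + ennreal (1 / 2) * 1 = 1"
    unfolding mult_1_right by (subst ennreal_plus[symmetric]) auto
  finally show "modular p (\<lambda>x. \<bar>indicator ?Q x\<bar> / (2 * s powr \<beta> * t)) \<le> 1"
    by (simp add: add_right_mono mult_left_mono)
qed (use s in auto)

lemma indicator_cube_Lvar:
  assumes "variable_exponent p" "0 < s"
  shows "indicator (cube a s) \<in> Lvar p"
  using Lvar_norm_cube(2)[OF assms, of a] by (auto simp: Lvar_norm_def split: if_splits)

lemma oscillation_sup_commutator:
  fixes b :: "real ^ 'n \<Rightarrow> real"
  assumes b: "locally_integrable b" and \<beta>: "\<beta> < 1" and pair: "(p, q) \<in> exponent_pairs_B \<beta>"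
    and bdd: "bounded_operator (maximal_commutator b) p q"
  shows "oscillation_sup \<beta> q b < \<infinity>"
proof -
  obtain \<theta> where \<theta>: "\<theta> = 1 - \<beta> / real CARD('n)" "0 < \<theta>" "\<theta> < 1"
    and p: "variable_exponent p" and q: "variable_exponent q"
    and pq: "\<And>x. p x / q x + p x * (1 - \<theta>) = 1"
    using exponent_pairs_BE[OF pair \<beta>] by metis
  obtain C where C: "0 \<le> C" "\<And>f. f \<in> Lvar p \<Longrightarrow> AE x in lebesgue. maximal_commutator b f x < \<infinity>"
    "\<And>f. f \<in> Lvar p \<Longrightarrow> Lvar_norm q (\<lambda>x. enn2real (maximal_commutator b f x)) \<le> ennreal C * Lvar_norm p f"
    using bdd unfolding bounded_operator_def by blast
  note meas = locally_integrable_measurable[OF b]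
  \<comment> \<open>\<open>C\<close> is the operator bound and 2 comes from
    \<open>Lvar_norm_cube_exponents\<close>.\<close>
  have "oscillation_sup \<beta> q b \<le> ennreal (2 * C)"
  proof (rule oscillation_sup_leI)
    fix a :: "real ^ 'n" and s :: real assume s: "0 < s"
    let ?Q = "cube a s"
    have Q: "indicator ?Q \<in> Lvar p"
      using p s by (rule indicator_cube_Lvar)
    have "AE x in lebesgue. \<bar>(b x - cube_average b ?Q) * indicator ?Q x\<bar>
        \<le> 1 * \<bar>enn2real (maximal_commutator b (indicator ?Q) x)\<bar>"
      \<comment> \<open>Finiteness matters: \<open>enn2real\<close> sends \<open>top\<close> to 0,
        which would destroy the lower bound.\<close>
      using C(2)[OF Q]
    proof eventually_elim
      case (elim x)
      show ?case
      proof (cases "x \<in> ?Q")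
        case True
        let ?d = "\<bar>b x - cube_average b ?Q\<bar>"
        have "ennreal (?d * s ^ CARD('n)) \<le> (\<integral>\<^sup>+ y \<in> ?Q. ennreal \<bar>b x - b y\<bar> \<partial>lebesgue)"
          using locally_integrable_cube[OF b] s by (rule abs_diff_cube_average_le)
        also have "\<dots> = (\<integral>\<^sup>+ y \<in> ?Q. ennreal (\<bar>b x - b y\<bar> * \<bar>indicator ?Q y\<bar>) \<partial>lebesgue)"
          by (intro nn_integral_cong) (auto simp: indicator_def)
        finally have "ennreal (?d * s ^ CARD('n)) / ennreal (s ^ CARD('n))
            \<le> (\<integral>\<^sup>+ y \<in> ?Q. ennreal (\<bar>b x - b y\<bar> * \<bar>indicator ?Q y\<bar>) \<partial>lebesgue) / emeasure lebesgue ?Q"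
          using s by (simp add: emeasure_cube divide_right_mono_ennreal)
        also have "\<dots> \<le> maximal_commutator b (indicator ?Q) x"
          unfolding maximal_commutator_def using s True by (intro SUP_upper) auto
        finally have "ennreal ?d \<le> maximal_commutator b (indicator ?Q) x"
          using s by (simp add: divide_ennreal)
        then have "?d \<le> enn2real (maximal_commutator b (indicator ?Q) x)"
          using elim enn2real_mono[of "ennreal ?d" "maximal_commutator b (indicator ?Q) x"] by simp
        then show ?thesis
          using True by simp
      qed simp
    qed
    then have "Lvar_norm q (\<lambda>x. (b x - cube_average b ?Q) * indicator ?Q x)
        \<le> ennreal 1 * Lvar_norm q (\<lambda>x. enn2real (maximal_commutator b (indicator ?Q) x))"
      by (intro Lvar_norm_mono_AE q borel_measurable_centred meas) auto
    also have "\<dots> \<le> ennreal C * Lvar_norm p (indicator ?Q)"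
      using C(3)[OF Q] by simp
    also have "\<dots> \<le> ennreal C * (ennreal (2 * s powr \<beta>) * Lvar_norm q (indicator ?Q))"
      by (intro mult_left_mono Lvar_norm_cube_exponents[OF p q \<theta> pq s]) simp
    also have "\<dots> = (ennreal C * ennreal (2 * s powr \<beta>)) * Lvar_norm q (indicator ?Q)"
      by (simp only: mult.assoc)
    also have "ennreal C * ennreal (2 * s powr \<beta>) = ennreal (2 * C * s powr \<beta>)"
      using C(1) by (subst ennreal_mult[symmetric]) (auto simp: ac_simps)
    finally show "Lvar_norm q (\<lambda>x. (b x - cube_average b ?Q) * indicator ?Q x)
        \<le> ennreal (2 * C * s powr \<beta>) * Lvar_norm q (indicator ?Q)" .
  qed (use C in simp)
  then show ?thesis
    by (rule le_less_trans) simp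
qed

section \<open>From oscillation in the variable exponent norm to oscillation in mean\<close>

text \<open>Let \<open>A\<close> be the average of
  \<open>G = \<bar>h\<bar> powr (1 / \<theta>)\<close> over the cube. The maximal function of
  \<open>G\<close> is at least \<open>A\<close> on the whole cube, so its boundedness bounds the
  norm of the indicator by \<open>(C / A) powr \<theta>\<close> times the norm of \<open>h\<close>
  on the cube, hence by \<open>(C / A) powr \<theta> * k\<close> times itself. Cancelling gives
  \<open>A powr \<theta> \<le> C powr \<theta> * k\<close>, and \<open>A powr \<theta>\<close>
  dominates the average of \<open>\<bar>h\<bar>\<close> by Hoelder's inequality.\<close>

lemma cube_average_le_Lvar_norm:
  fixes q :: "real ^ 'n \<Rightarrow> real"
  assumes q: "variable_exponent q" and r: "variable_exponent (\<lambda>x. \<theta> * q x)" and \<theta>: "0 < \<theta>" "\<theta> < 1"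
    and M: "bounded_operator maximal_function (\<lambda>x. \<theta> * q x) (\<lambda>x. \<theta> * q x)"
  obtains C where "0 < C" "\<And>h a s k. h \<in> borel_measurable lebesgue \<Longrightarrow> 0 < s \<Longrightarrow> 0 < k \<Longrightarrow>
    Lvar_norm q (\<lambda>x. h x * indicator (cube a s) x) \<le> ennreal k * Lvar_norm q (indicator (cube a s)) \<Longrightarrow>
    (\<integral>\<^sup>+ y \<in> cube a s. ennreal \<bar>h y\<bar> \<partial>lebesgue) \<le> ennreal (C * k * s ^ CARD('n))"
proof -
  let ?r = "\<lambda>x. \<theta> * q x"
  obtain C where C: "0 < C"
    "\<And>f. f \<in> Lvar ?r \<Longrightarrow> AE x in lebesgue. maximal_function f x < \<infinity>"
    "\<And>f t. f \<in> borel_measurable lebesgue \<Longrightarrow> 0 < t \<Longrightarrow> modular ?r (\<lambda>x. \<bar>f x\<bar> / t) \<le> 1 \<Longrightarrow>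
       modular ?r (\<lambda>x. \<bar>enn2real (maximal_function f x)\<bar> / (C * t)) \<le> 1"
    using bounded_operator_modularD[OF M r] by metis
  show ?thesis
  proof (rule that[of "C powr \<theta>"])
    fix h :: "real ^ 'n \<Rightarrow> real" and a :: "real ^ 'n" and s k :: real
    assume h [measurable]: "h \<in> borel_measurable lebesgue" and s: "0 < s" and k: "0 < k"
      and hk: "Lvar_norm q (\<lambda>x. h x * indicator (cube a s) x) \<le> ennreal k * Lvar_norm q (indicator (cube a s))"
    let ?Q = "cube a s" and ?n = "CARD('n)"
    let ?H = "\<lambda>x. h x * indicator ?Q x"
    define G where "G = (\<lambda>x. \<bar>?H x\<bar> powr (1 / \<theta>))"
    have [measurable]: "G \<in> borel_measurable lebesgue"
      unfolding G_def by measurable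
    have Y: "0 < Lvar_norm q (indicator ?Q)" "Lvar_norm q (indicator ?Q) < top"
      using q s by (rule Lvar_norm_cube)+
    have "Lvar_norm q ?H < top"
      using hk Y(2) by (auto simp: ennreal_mult_less_top intro: le_less_trans)
    have G_modular: "modular ?r (\<lambda>x. \<bar>G x\<bar> / (t powr (1 / \<theta>))) = modular q (\<lambda>x. \<bar>?H x\<bar> / t)" if "0 < t" for t
    proof -
      have *: "\<bar>\<bar>\<bar>?H x\<bar> powr (1 / \<theta>)\<bar> / t powr (1 / \<theta>)\<bar> powr (\<theta> * q x) = \<bar>\<bar>?H x\<bar> / t\<bar> powr q x" for x
      proof -
        have "\<bar>\<bar>\<bar>?H x\<bar> powr (1 / \<theta>)\<bar> / t powr (1 / \<theta>)\<bar> = (\<bar>?H x\<bar> / t) powr (1 / \<theta>)"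
          using that by (simp add: powr_divide)
        then show ?thesis
          using that \<theta> by (simp add: powr_powr)
      qed
      then show ?thesis
        by (simp only: modular_def G_def *)
    qed
    obtain A where A: "0 \<le> A" "\<And>x. x \<in> ?Q \<Longrightarrow> ennreal A \<le> maximal_function G x"
        "(\<integral>\<^sup>+ y \<in> ?Q. ennreal (G y) \<partial>lebesgue) = ennreal (A * s ^ ?n)" and fin: "AE x in lebesgue. maximal_function G x < \<infinity>"
    proof -
      obtain N where N: "Lvar_norm q ?H = ennreal N" "0 \<le> N"
        using \<open>Lvar_norm q ?H < top\<close> by (cases "Lvar_norm q ?H") auto
      have N1: "modular q (\<lambda>x. \<bar>?H x\<bar> / (N + 1)) \<le> 1"
        using N by (intro Lvar_norm_lessD[OF q]) (simp add: ennreal_less_iff)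
      have "modular ?r (\<lambda>x. \<bar>G x\<bar> / ((N + 1) powr (1 / \<theta>))) \<le> 1"
        using N1 N by (subst G_modular) auto
      then have "modular ?r (\<lambda>x. \<bar>G x\<bar> / ((N + 1) powr (1 / \<theta>))) < \<infinity>"
        by (rule le_less_trans) simp
      then have "G \<in> Lvar ?r"
        using N unfolding Lvar_def by (auto intro!: exI[of _ "(N + 1) powr (1 / \<theta>)"])
      then have fin: "AE x in lebesgue. maximal_function G x < \<infinity>"
        by (rule C)
      let ?I = "\<integral>\<^sup>+ y \<in> ?Q. ennreal \<bar>G y\<bar> \<partial>lebesgue"
      have le: "?I / ennreal (s ^ ?n) \<le> maximal_function G x" if "x \<in> ?Q" for x
        unfolding maximal_function_def
        using that s by (intro SUP_upper2[of ?Q]) (auto simp: emeasure_cube)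
      \<comment> \<open>One such point suffices to make the average finite. It exists because the
        cube has positive measure and the maximal function is finite almost everywhere.\<close>
      have "\<exists>x\<in>?Q. maximal_function G x < \<infinity>"
      proof (rule ccontr)
        assume "\<not> ?thesis"
        then have "AE x in lebesgue. x \<notin> ?Q"
          using fin by (auto elim: eventually_mono)
        then have "emeasure lebesgue ?Q = 0"
          by (subst (asm) AE_iff_measurable[OF _ refl]) auto
        then show False
          using s by (simp add: emeasure_cube)
      qed
      then obtain x0 where "x0 \<in> ?Q" "maximal_function G x0 < \<infinity>" by blast
      then have "?I / ennreal (s ^ ?n) < top"
        using le[of x0] by (auto intro: le_less_trans)
      then obtain A where A: "?I / ennreal (s ^ ?n) = ennreal A" "0 \<le> A"
        by (cases "?I / ennreal (s ^ ?n)") auto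
      have "?I = ?I / ennreal (s ^ ?n) * ennreal (s ^ ?n)"
        using s by (simp add: ennreal_divide_times)
      also have "\<dots> = ennreal (A * s ^ ?n)"
        using A s by (simp add: ennreal_mult)
      finally have "(\<integral>\<^sup>+ y \<in> ?Q. ennreal (G y) \<partial>lebesgue) = ennreal (A * s ^ ?n)"
        by (simp add: G_def)
      then show thesis
        using A le fin by (intro that[of A]) auto
    qed
    have GA: "A powr \<theta> \<le> C powr \<theta> * k"
    \<comment> \<open>The argument divides by \<open>A\<close>; for \<open>A = 0\<close> the claim
      is immediate.\<close>
    proof (cases "A = 0")
      case True
      then show ?thesis using \<theta> k by simp
    next
      case False
      then have A_pos: "0 < A" using A by simp
      have "Lvar_norm q (indicator ?Q) \<le> ennreal ((C / A) powr \<theta>) * Lvar_norm q ?H"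
      proof (rule Lvar_norm_le_cmult[OF q])
        show "0 < (C / A) powr \<theta>"
          using C A_pos by simp
        fix t :: real assume t: "0 < t" "modular q (\<lambda>x. \<bar>?H x\<bar> / t) \<le> 1"
        have "AE x in lebesgue. \<bar>\<bar>indicator ?Q x\<bar> / ((C / A) powr \<theta> * t)\<bar>
            \<le> \<bar>(\<bar>enn2real (maximal_function G x)\<bar> / (C * t powr (1 / \<theta>))) powr \<theta>\<bar>"
          using fin
        proof eventually_elim
          case (elim x)
          show ?case
          proof (cases "x \<in> ?Q")
            case True
            have "A \<le> enn2real (maximal_function G x)"
              using A(1) enn2real_mono[OF A(2)[OF True]] elim by simp
            then have "(A / (C * t powr (1 / \<theta>))) powr \<theta> \<le> (\<bar>enn2real (maximal_function G x)\<bar> / (C * t powr (1 / \<theta>))) powr \<theta>"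
              using A C t \<theta> by (intro powr_mono2 divide_right_mono) auto
            moreover have "(A / (C * t powr (1 / \<theta>))) powr \<theta> = 1 / ((C / A) powr \<theta> * t)"
              using A_pos C t \<theta> by (simp add: powr_divide powr_mult powr_powr)
            ultimately show ?thesis
              using True t by simp
          qed simp
        qed
        then have "modular q (\<lambda>x. \<bar>indicator ?Q x\<bar> / ((C / A) powr \<theta> * t))
            \<le> modular q (\<lambda>x. (\<bar>enn2real (maximal_function G x)\<bar> / (C * t powr (1 / \<theta>))) powr \<theta>)"
          by (rule modular_mono_AE[OF q])
        also have "\<dots> = modular ?r (\<lambda>x. \<bar>enn2real (maximal_function G x)\<bar> / (C * t powr (1 / \<theta>)))"
          using C by (simp add: modular_def powr_powr)
        also have "\<dots> \<le> 1"
          \<comment> \<open>The bound is taken at scale \<open>t powr (1 / \<theta>)\<close>, where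
            the modular of \<open>G\<close> equals that of \<open>?H\<close> at scale
            \<open>t\<close>.\<close>
          using t by (intro C) (auto simp: G_modular)
        finally show "modular q (\<lambda>x. \<bar>indicator ?Q x\<bar> / ((C / A) powr \<theta> * t)) \<le> 1" .
      qed measurable
      also have "\<dots> \<le> ennreal ((C / A) powr \<theta>) * (ennreal k * Lvar_norm q (indicator ?Q))"
        using hk by (rule mult_left_mono) simp
      also have "\<dots> = ennreal ((C / A) powr \<theta> * k) * Lvar_norm q (indicator ?Q)"
        using k by (simp add: ennreal_mult mult.assoc)
      finally have le: "Lvar_norm q (indicator ?Q) \<le> ennreal ((C / A) powr \<theta> * k) * Lvar_norm q (indicator ?Q)" .
      have "1 \<le> (C / A) powr \<theta> * k"
      proof -
        obtain y where y: "Lvar_norm q (indicator ?Q) = ennreal y" "0 \<le> y"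
          using Y by (cases "Lvar_norm q (indicator ?Q)") auto
        have "0 < y"
          using Y y by simp
        moreover have "y \<le> (C / A) powr \<theta> * k * y"
          using le y k by (simp add: ennreal_mult[symmetric])
        ultimately show ?thesis by simp
      qed
      then show ?thesis
        using A_pos C by (simp add: powr_divide field_simps)
    qed
    have "(\<integral>\<^sup>+ y \<in> ?Q. ennreal \<bar>h y\<bar> \<partial>lebesgue) = (\<integral>\<^sup>+ y. ennreal (G y powr \<theta> * (indicator ?Q y) powr (1 - \<theta>)) \<partial>lebesgue)"
      using \<theta> by (intro nn_integral_cong) (auto simp: G_def powr_powr indicator_def)
    also have "\<dots> \<le> ennreal ((A * s ^ ?n) powr \<theta> * (s ^ ?n) powr (1 - \<theta>))"
    \<comment> \<open>The second factor is the indicator of the cube, so this is Jensen's inequality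
      for the power \<theta>.\<close>
    proof (rule nn_integral_Holder)
      have "(\<integral>\<^sup>+ y. ennreal (G y) \<partial>lebesgue) = (\<integral>\<^sup>+ y \<in> ?Q. ennreal (G y) \<partial>lebesgue)"
        by (intro nn_integral_cong) (auto simp: G_def indicator_def)
      then show "(\<integral>\<^sup>+ y. ennreal (G y) \<partial>lebesgue) \<le> ennreal (A * s ^ ?n)"
        using A by simp
      have "(\<integral>\<^sup>+ y. ennreal (indicator ?Q y) \<partial>lebesgue) = (\<integral>\<^sup>+ y. indicator ?Q y \<partial>lebesgue)"
        by (intro nn_integral_cong) (auto simp: indicator_def)
      then show "(\<integral>\<^sup>+ y. ennreal (indicator ?Q y) \<partial>lebesgue) \<le> ennreal (s ^ ?n)"
        using s by (simp add: emeasure_cube)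
    qed (use A s \<theta> in \<open>auto simp: G_def\<close>)
    also have "(A * s ^ ?n) powr \<theta> * (s ^ ?n) powr (1 - \<theta>) = A powr \<theta> * s ^ ?n"
      using A s by (simp add: powr_mult flip: powr_add)
    also have "ennreal (A powr \<theta> * s ^ ?n) \<le> ennreal (C powr \<theta> * k * s ^ ?n)"
      using GA s by (intro ennreal_leI mult_right_mono) auto
    finally show "(\<integral>\<^sup>+ y \<in> ?Q. ennreal \<bar>h y\<bar> \<partial>lebesgue) \<le> ennreal (C powr \<theta> * k * s ^ ?n)" .
  qed (use C in simp)
qed

section \<open>Campanato's characterisation of Lipschitz functions\<close>

lemma cube_mono: "s \<le> t \<Longrightarrow> cube a s \<subseteq> cube a t"
  unfolding subset_iff mem_cube by (meson add_left_mono order_trans)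

text \<open>Restricting the oscillation to a subcube of at least half the side costs the ratio of
  volumes, at most \<open>2 ^ CARD('n)\<close>.\<close>

lemma cube_average_diff_le:
  fixes b :: "real ^ 'n \<Rightarrow> real"
  assumes b: "locally_integrable b" and sub: "cube c u \<subseteq> cube a s" and u: "0 < u" and K: "0 \<le> K"
    and osc: "(\<integral>\<^sup>+ y \<in> cube a s. ennreal \<bar>b y - cube_average b (cube a s)\<bar> \<partial>lebesgue) \<le> ennreal (K * s ^ CARD('n))"
    and su: "0 < s" "s \<le> 2 * u"
  shows "\<bar>cube_average b (cube c u) - cube_average b (cube a s)\<bar> \<le> 2 ^ CARD('n) * K"
proof -
  let ?m = "cube_average b (cube a s)"
  have "ennreal (\<bar>?m - cube_average b (cube c u)\<bar> * u ^ CARD('n)) \<le> (\<integral>\<^sup>+ y \<in> cube c u. ennreal \<bar>?m - b y\<bar> \<partial>lebesgue)"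
    using locally_integrable_cube[OF b] u by (rule abs_diff_cube_average_le)
  also have "\<dots> \<le> (\<integral>\<^sup>+ y \<in> cube a s. ennreal \<bar>b y - ?m\<bar> \<partial>lebesgue)"
    using sub by (intro nn_integral_mono) (auto simp: indicator_def abs_minus_commute)
  also have "\<dots> \<le> ennreal (K * s ^ CARD('n))"
    by (rule osc)
  also have "\<dots> \<le> ennreal (K * (2 * u) ^ CARD('n))"
    using su K by (intro ennreal_leI mult_left_mono power_mono) auto
  finally have "\<bar>?m - cube_average b (cube c u)\<bar> * u ^ CARD('n) \<le> (2 ^ CARD('n) * K) * u ^ CARD('n)"
    using K u by (subst (asm) ennreal_le_iff) (auto simp: power_mult_distrib ac_simps)
  then show ?thesis
    using u by (simp add: abs_minus_commute)
qed

lemma cube_eq_cbox_One: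
  fixes x :: "real ^ 'n"
  shows "cbox x (x + h *\<^sub>R One) = cube x h"
proof -
  have "One $ i = (1 :: real)" for i :: 'n
    by (simp add: cart_eq_inner_axis axis_in_Basis_iff)
  then have "x + h *\<^sub>R One = (\<chi> i. x $ i + h)"
    by (simp add: vec_eq_iff)
  then show ?thesis
    by (simp add: cube_def)
qed

text \<open>Lebesgue's differentiation theorem for cubes with \<open>x\<close> as lower corner. The
  sequence \<open>h\<close> is quantified inside \<open>AE\<close> so that one null set serves all
  sequences.\<close>

lemma cube_averages_tendsto:
  fixes b :: "real ^ 'n \<Rightarrow> real"
  assumes b: "locally_integrable b"
  shows "AE x in lebesgue. \<forall>h. (\<forall>k. 0 < h k) \<longrightarrow> h \<longlonglongrightarrow> 0 \<longrightarrow> (\<lambda>k :: nat. cube_average b (cube x (h k))) \<longlonglongrightarrow> b x"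
proof -
  have int: "b integrable_on cbox u v" for u v
    using b by (auto simp: locally_integrable_def intro!: set_lebesgue_integral_eq_integral(1))
  obtain N where N: "negligible N"
    "\<And>x e. x \<notin> N \<Longrightarrow> 0 < e \<Longrightarrow> \<exists>d>0. \<forall>h. 0 < h \<and> h < d \<longrightarrow>
       norm (integral (cbox x (x + h *\<^sub>R One)) b /\<^sub>R h ^ DIM(real ^ 'n) - b x) < e"
    using integrable_ccontinuous_explicit[OF int] by blast
  have avg: "integral (cbox x (x + h *\<^sub>R One)) b /\<^sub>R h ^ DIM(real ^ 'n) = cube_average b (cube x h)" if "0 < h" for x h
    using that set_lebesgue_integral_eq_integral(2)[OF locally_integrable_cube[OF b], of x h]
    by (simp add: cube_eq_cbox_One cube_average_def measure_cube divide_inverse mult.commute)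
  have lim: "(\<lambda>k. cube_average b (cube x (h k))) \<longlonglongrightarrow> b x"
    if x: "x \<notin> N" and h: "\<forall>k. 0 < h k" "h \<longlonglongrightarrow> 0" for x and h :: "nat \<Rightarrow> real"
  proof (rule tendstoI)
    fix e :: real assume "0 < e"
    then obtain d where d: "0 < d" "\<And>h. 0 < h \<Longrightarrow> h < d \<Longrightarrow>
        norm (integral (cbox x (x + h *\<^sub>R One)) b /\<^sub>R h ^ DIM(real ^ 'n) - b x) < e"
      using N(2)[OF x, of e] by blast
    have "\<forall>\<^sub>F k in sequentially. h k < d"
      using h(2) d(1) by (rule order_tendstoD)
    then show "\<forall>\<^sub>F k in sequentially. dist (cube_average b (cube x (h k))) (b x) < e"
    proof eventually_elim
      case (elim k)
      then show ?case
        using d(2)[of "h k"] h(1) unfolding avg[OF h(1)[THEN spec]] by (simp add: dist_real_def)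
    qed
  qed
  have "N \<in> null_sets lebesgue"
    using N(1) by (simp add: negligible_iff_null_sets)
  then have "AE x in lebesgue. x \<notin> N"
    by (rule AE_not_in)
  then show ?thesis
    by eventually_elim (use lim in blast)
qed

text \<open>The fractions \<open>x / (x + y)\<close> and \<open>y / (x + y)\<close> sum to 1, and on
  the unit interval \<open>t \<le> t powr \<beta>\<close>. This is the triangle inequality for
  \<open>norm (x - y) powr \<beta>\<close>.\<close>

lemma powr_add_le:
  fixes x y :: real
  assumes "0 \<le> x" "0 \<le> y" "0 < \<beta>" "\<beta> \<le> 1"
  shows "(x + y) powr \<beta> \<le> x powr \<beta> + y powr \<beta>"
proof (cases "x + y = 0")
  case False
  let ?z = "x + y"
  have z: "0 < ?z"
    using False assms by simp
  have le: "w / ?z \<le> (w / ?z) powr \<beta>" if "0 \<le> w" "w \<le> ?z" for w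
    using powr_mono'[of \<beta> 1 "w / ?z"] that z assms by simp
  have "1 = x / ?z + y / ?z"
    using z by (simp flip: add_divide_distrib)
  also have "\<dots> \<le> (x / ?z) powr \<beta> + (y / ?z) powr \<beta>"
    using assms by (intro add_mono le) auto
  also have "\<dots> = (x powr \<beta> + y powr \<beta>) / ?z powr \<beta>"
    using assms z by (simp add: powr_divide add_divide_distrib)
  finally show ?thesis
    using z by (simp add: pos_le_divide_eq)
qed (use assms in simp)

text \<open>McShane's extension, for the metric \<open>norm (x - y) powr \<beta>\<close>.\<close>

lemma Lipschitz_powr_extension:
  fixes f :: "'a :: real_normed_vector \<Rightarrow> real"
  assumes f: "\<And>x y. x \<in> D \<Longrightarrow> y \<in> D \<Longrightarrow> \<bar>f x - f y\<bar> \<le> L * norm (x - y) powr \<beta>"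
    and L: "0 \<le> L" and \<beta>: "0 < \<beta>" "\<beta> \<le> 1"
  obtains g where "\<And>x. x \<in> D \<Longrightarrow> g x = f x" "\<And>x y. \<bar>g x - g y\<bar> \<le> L * norm (x - y) powr \<beta>"
\<comment> \<open>The extension is an infimum over \<open>D\<close>, which is meaningful in the
  reals only if \<open>D\<close> is nonempty.\<close>
proof (cases "D = {}")
  case True
  then show ?thesis
    using L by (intro that[of "\<lambda>_. 0"]) auto
next
  case False
  then obtain y0 where y0: "y0 \<in> D" by blast
  let ?d = "\<lambda>x y. L * norm (x - y) powr \<beta>"
  have tri: "?d x z \<le> ?d x y + ?d y z" for x y z :: 'a
  proof -
    have "norm (x - z) powr \<beta> \<le> (norm (x - y) + norm (y - z)) powr \<beta>"
      using \<beta> norm_triangle_ineq[of "x - y" "y - z"] by (intro powr_mono2) auto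
    also have "\<dots> \<le> norm (x - y) powr \<beta> + norm (y - z) powr \<beta>"
      using \<beta> by (intro powr_add_le) auto
    finally show ?thesis
      using L by (simp add: mult_left_mono flip: distrib_left)
  qed
  have sym: "?d x y = ?d y x" for x y
    by (simp add: norm_minus_commute)
  define g where "g x = (INF y\<in>D. f y + ?d x y)" for x
  have lower: "f z - ?d x z \<le> f y + ?d x y" if "y \<in> D" "z \<in> D" for x y z
    using f[OF that] tri[of y z x] sym[of x y] by (auto simp: abs_le_iff)
  have bdd: "bdd_below ((\<lambda>y. f y + ?d x y) ` D)" for x
    using lower[OF _ y0] by (intro bdd_belowI2[of _ "f y0 - ?d x y0"]) auto
  have upper: "g x \<le> f y + ?d x y" if "y \<in> D" for x y
    unfolding g_def using bdd that by (rule cINF_lower)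
  have g_le: "g x \<le> g y + ?d x y" for x y
  proof -
    have "g x - ?d x y \<le> f z + ?d y z" if "z \<in> D" for z
      using upper[OF that, of x] tri[of x z y] by linarith
    then have "g x - ?d x y \<le> g y"
      unfolding g_def[of y] using False by (intro cINF_greatest) auto
    then show ?thesis by simp
  qed
  show ?thesis
  proof (rule that[of g])
    show "\<bar>g x - g y\<bar> \<le> ?d x y" for x y
      using g_le[of x y] g_le[of y x] sym[of x y] by (auto simp: abs_le_iff)
    fix x assume x: "x \<in> D"
    have "g x \<le> f x"
      using upper[OF x, of x] by simp
    moreover have "f x \<le> g x"
      unfolding g_def using lower[OF _ x, of _ x] False by (intro cINF_greatest) auto
    ultimately show "g x = f x" by simp
  qed
qed

text \<open>At a Lebesgue point the distance of \<open>b x\<close> from the average over a cube of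
  side \<open>s\<close> at \<open>x\<close> is bounded by a geometric series with sum of order
  \<open>s powr \<beta>\<close>. Two points at distance \<open>s\<close> are linked by a cube of
  side \<open>2 * s\<close>.\<close>

lemma lipschitz_space_oscillationI:
  fixes b :: "real ^ 'n \<Rightarrow> real"
  assumes b: "locally_integrable b" and \<beta>: "0 < \<beta>" "\<beta> < 1" and K: "0 \<le> K"
    and osc: "\<And>a s. 0 < s \<Longrightarrow>
      (\<integral>\<^sup>+ y \<in> cube a s. ennreal \<bar>b y - cube_average b (cube a s)\<bar> \<partial>lebesgue) \<le> ennreal (K * s powr \<beta> * s ^ CARD('n))"
  shows "b \<in> lipschitz_space \<beta>"
proof -
  let ?N = "2 ^ CARD('n) :: real"
  \<comment> \<open>Halving the side multiplies \<open>s powr \<beta>\<close> by \<rho>, the ratio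
    of the geometric series.\<close>
  define \<rho> :: real where "\<rho> = (1 / 2) powr \<beta>"
  have \<rho>: "0 \<le> \<rho>" "\<rho> < 1"
    using \<beta> powr_less_mono2[of \<beta> "1 / 2" 1] by (auto simp: \<rho>_def)
  have diff: "\<bar>cube_average b (cube c u) - cube_average b (cube a s)\<bar> \<le> ?N * K * s powr \<beta>"
    if "cube c u \<subseteq> cube a s" "0 < u" "0 < s" "s \<le> 2 * u" for a c :: "real ^ 'n" and s u
    using cube_average_diff_le[OF b that(1,2) _ osc[OF that(3)] that(3,4)] K by (simp add: mult.assoc)
  define D where "D = {x. \<forall>h. (\<forall>k. 0 < h k) \<longrightarrow> h \<longlonglongrightarrow> 0 \<longrightarrow> (\<lambda>k :: nat. cube_average b (cube x (h k))) \<longlonglongrightarrow> b x}"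
  have corner: "\<bar>b x - cube_average b (cube x s)\<bar> \<le> ?N * K / (1 - \<rho>) * s powr \<beta>" if x: "x \<in> D" and s: "0 < s" for x s
  proof -
    define h where "h k = s * (1 / 2) ^ k" for k :: nat
    define m where "m k = cube_average b (cube x (h k))" for k
    have h: "0 < h k" for k
      using s by (simp add: h_def)
    have "h \<longlonglongrightarrow> s * 0"
      unfolding h_def by (intro tendsto_intros LIMSEQ_realpow_zero) auto
    then have "h \<longlonglongrightarrow> 0"
      by simp
    with x h have lim: "m \<longlonglongrightarrow> b x"
      unfolding D_def m_def[abs_def] by blast
    have step: "\<bar>m (Suc k) - m k\<bar> \<le> ?N * K * s powr \<beta> * \<rho> ^ k" for k
    proof -
      have "\<bar>m (Suc k) - m k\<bar> \<le> ?N * K * h k powr \<beta>"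
        unfolding m_def
      proof (rule diff)
        have "h (Suc k) \<le> h k"
          using s by (simp add: h_def)
        then show "cube x (h (Suc k)) \<subseteq> cube x (h k)"
          by (rule cube_mono)
      qed (use h in \<open>auto simp: h_def\<close>)
      also have "h k powr \<beta> = s powr \<beta> * \<rho> ^ k"
      proof -
        have "((1 / 2 :: real) ^ k) powr \<beta> = (1 / 2) powr (real k * \<beta>)"
          by (rule powr_of_power) simp
        also have "\<dots> = \<rho> ^ k"
          unfolding \<rho>_def by (subst powr_power) auto
        finally show ?thesis
          using s by (simp only: h_def powr_mult less_imp_le zero_le_power zero_le_divide_1_iff zero_le_numeral)
      qed
      finally show ?thesis by (simp add: mult.assoc)
    qed
    have tele: "\<bar>m k - m 0\<bar> \<le> ?N * K * s powr \<beta> * (\<Sum>j<k. \<rho> ^ j)" for k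
    proof (induction k)
      case (Suc k)
      then show ?case
        using step[of k] by (simp add: distrib_left)
    qed simp
    have geo: "?N * K * s powr \<beta> * (\<Sum>j<k. \<rho> ^ j) \<le> ?N * K * s powr \<beta> * (1 / (1 - \<rho>))" for k
    proof (rule mult_left_mono)
      have "(\<Sum>j<k. \<rho> ^ j) = (1 - \<rho> ^ k) / (1 - \<rho>)"
        using \<rho> by (subst sum_gp_strict) auto
      also have "\<dots> \<le> 1 / (1 - \<rho>)"
        using \<rho> by (intro divide_right_mono) auto
      finally show "(\<Sum>j<k. \<rho> ^ j) \<le> 1 / (1 - \<rho>)" .
    qed (use K in simp)
    have "?N * K * s powr \<beta> * (1 / (1 - \<rho>)) = ?N * K / (1 - \<rho>) * s powr \<beta>"
      by simp
    then have "\<bar>m k - m 0\<bar> \<le> ?N * K / (1 - \<rho>) * s powr \<beta>" for k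
      using order_trans[OF tele geo, of k] by (simp only:)
    moreover have "(\<lambda>k. \<bar>m k - m 0\<bar>) \<longlonglongrightarrow> \<bar>b x - m 0\<bar>"
      by (intro tendsto_intros lim)
    ultimately have "\<bar>b x - m 0\<bar> \<le> ?N * K / (1 - \<rho>) * s powr \<beta>"
      by (intro LIMSEQ_le_const2) auto
    then show ?thesis
      by (simp add: m_def h_def)
  qed
  \<comment> \<open>Twice the constant of \<open>corner\<close>, plus one passage to the common cube
    for each of the two points; each costs \<open>2 * ?N * K\<close> because
    \<open>(2 * s) powr \<beta> \<le> 2 * s powr \<beta>\<close>.\<close>
  define L where "L = 2 * (?N * K / (1 - \<rho>)) + 4 * ?N * K"
  have L: "0 \<le> L"
    using K \<rho> by (simp add: L_def)
  have Lip: "\<bar>b x - b y\<bar> \<le> L * norm (x - y) powr \<beta>" if x: "x \<in> D" and y: "y \<in> D" for x y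
  proof (cases "x = y")
    case False
    define s where "s = norm (x - y)"
    have s: "0 < s"
      using False by (simp add: s_def)
    \<comment> \<open>Each of \<open>x\<close> and \<open>y\<close> exceeds the componentwise
      minimum by at most \<open>s\<close> in every coordinate, so the cube of side
      \<open>2 * s\<close> at \<open>a\<close> contains the cubes of side \<open>s\<close> at both
      points.\<close>
    define a :: "real ^ 'n" where "a = (\<chi> i. min (x $ i) (y $ i))"
    have xy: "\<bar>x $ i - y $ i\<bar> \<le> s" for i
      using component_le_norm_cart[of "x - y" i] by (simp add: s_def)
    have le: "\<bar>x $ i - a $ i\<bar> \<le> s" "\<bar>y $ i - a $ i\<bar> \<le> s" "a $ i \<le> x $ i" "a $ i \<le> y $ i" for i
      using xy[of i] s by (auto simp: a_def min_def)
    have sub: "cube z s \<subseteq> cube a (2 * s)" if "\<And>i. \<bar>z $ i - a $ i\<bar> \<le> s" "\<And>i. a $ i \<le> z $ i" for z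
    proof
      fix w assume w: "w \<in> cube z s"
      show "w \<in> cube a (2 * s)"
        unfolding mem_cube
      proof
        fix i
        show "a $ i \<le> w $ i \<and> w $ i \<le> a $ i + 2 * s"
          using w[unfolded mem_cube, THEN spec, of i] that[of i] by auto
      qed
    qed
    have "\<bar>cube_average b (cube x s) - cube_average b (cube a (2 * s))\<bar> \<le> ?N * K * (2 * s) powr \<beta>"
      "\<bar>cube_average b (cube y s) - cube_average b (cube a (2 * s))\<bar> \<le> ?N * K * (2 * s) powr \<beta>"
      using s by (auto intro!: diff[OF sub[OF le(1,3)]] diff[OF sub[OF le(2,4)]])
    moreover have "?N * K * (2 * s) powr \<beta> \<le> 2 * ?N * K * s powr \<beta>"
    proof -
      have "2 powr \<beta> \<le> (2 :: real) powr 1"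
        using \<beta> by (intro powr_mono) auto
      then have "(2 powr \<beta>) * (?N * K * s powr \<beta>) \<le> 2 * (?N * K * s powr \<beta>)"
        using K by (intro mult_right_mono) auto
      then show ?thesis
        using s by (simp add: powr_mult ac_simps)
    qed
    ultimately have "\<bar>b x - b y\<bar> \<le> 2 * (?N * K / (1 - \<rho>) * s powr \<beta>) + 2 * (2 * ?N * K * s powr \<beta>)"
      using corner[OF x s] corner[OF y s] by linarith
    then show ?thesis
      by (simp add: L_def s_def algebra_simps)
  qed simp
  \<comment> \<open>The estimate holds only on \<open>D\<close>, while membership in
    \<open>lipschitz_space\<close> asks for a representative that is Lipschitz everywhere.\<close>
  obtain g where g: "\<And>x. x \<in> D \<Longrightarrow> g x = b x" "\<And>x y. \<bar>g x - g y\<bar> \<le> L * norm (x - y) powr \<beta>"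
    by (rule Lipschitz_powr_extension[OF Lip L \<beta>(1) less_imp_le[OF \<beta>(2)]]) blast+
  have "AE x in lebesgue. b x = g x"
    using cube_averages_tendsto[OF b] by eventually_elim (use g in \<open>auto simp: D_def\<close>)
  then show ?thesis
    unfolding lipschitz_space_def using g(2) by blast
qed

lemma oscillation_sup_imp_lipschitz:
  fixes b :: "real ^ 'n \<Rightarrow> real"
  assumes b: "locally_integrable b" and \<beta>: "0 < \<beta>" "\<beta> < 1" and pair: "(p, q) \<in> exponent_pairs_B \<beta>"
    and osc: "oscillation_sup \<beta> q b < \<infinity>"
  shows "b \<in> lipschitz_space \<beta>"
proof -
  obtain \<theta> where \<theta>: "0 < \<theta>" "\<theta> < 1" and q: "variable_exponent q" and r: "variable_exponent (\<lambda>x. \<theta> * q x)"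
    and M: "bounded_operator maximal_function (\<lambda>x. \<theta> * q x) (\<lambda>x. \<theta> * q x)"
    using exponent_pairs_BE[OF pair \<beta>(2)] by metis
  note [measurable] = locally_integrable_measurable[OF b]
  show ?thesis
  proof (rule cube_average_le_Lvar_norm[OF q r \<theta> M])
    fix C assume C: "0 < C" "\<And>h a s k. h \<in> borel_measurable lebesgue \<Longrightarrow> 0 < s \<Longrightarrow> 0 < k \<Longrightarrow>
      Lvar_norm q (\<lambda>x. h x * indicator (cube a s) x) \<le> ennreal k * Lvar_norm q (indicator (cube a s)) \<Longrightarrow>
      (\<integral>\<^sup>+ y \<in> cube a s. ennreal \<bar>h y\<bar> \<partial>lebesgue) \<le> ennreal (C * k * s ^ CARD('n))"
    show "b \<in> lipschitz_space \<beta>"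
    proof (rule oscillation_supD[OF osc q])
      fix K assume K: "0 < K" "\<And>a s. 0 < s \<Longrightarrow>
        Lvar_norm q (\<lambda>x. (b x - cube_average b (cube a s)) * indicator (cube a s) x)
          \<le> ennreal (K * s powr \<beta>) * Lvar_norm q (indicator (cube a s))"
      show "b \<in> lipschitz_space \<beta>"
      proof (rule lipschitz_space_oscillationI[OF b \<beta>])
        show "0 \<le> C * K"
          using C(1) K(1) by simp
        fix a :: "real ^ 'n" and s :: real assume s: "0 < s"
        have "(\<integral>\<^sup>+ y \<in> cube a s. ennreal \<bar>b y - cube_average b (cube a s)\<bar> \<partial>lebesgue)
            \<le> ennreal (C * (K * s powr \<beta>) * s ^ CARD('n))"
          \<comment> \<open>Here \<open>h\<close> is \<open>b\<close> minus its average over the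
            cube, and \<open>k\<close> is \<open>K * s powr \<beta>\<close>.\<close>
          by (rule C(2)[OF _ s _ K(2)[OF s]]) (use s K(1) in auto)
        then show "(\<integral>\<^sup>+ y \<in> cube a s. ennreal \<bar>b y - cube_average b (cube a s)\<bar> \<partial>lebesgue)
            \<le> ennreal (C * K * s powr \<beta> * s ^ CARD('n))"
          by (simp only: mult.assoc)
      qed
    qed
  qed
qed

section \<open>The maximal theorem in \<open>L\<^sup>2\<close>\<close>

text \<open>Vitali's covering lemma, applied to balls containing the cubes that witness \<open>\<kappa> < M f\<close>.\<close>

lemma maximal_function_weak_type:
  fixes f :: "real ^ 'n \<Rightarrow> real"
  assumes f [measurable]: "f \<in> borel_measurable lebesgue" and \<kappa>: "0 < \<kappa>"
  shows "emeasure lebesgue {x. ennreal \<kappa> < maximal_function f x}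
    \<le> ennreal (unit_ball_vol (real CARD('n)) * (5 * real CARD('n)) ^ CARD('n) / \<kappa>) * (\<integral>\<^sup>+ x. ennreal \<bar>f x\<bar> \<partial>lebesgue)"
    (is "emeasure _ ?E \<le> ennreal (?W / \<kappa>) * ?I")
\<comment> \<open>A finite integral is what bounds the radii below; an infinite one makes the
  right-hand side \<open>top\<close>, as its factor is positive.\<close>
proof (cases "?I = top")
  case True
  have "0 < ?W / \<kappa>"
    using \<kappa> by simp
  then have "ennreal (?W / \<kappa>) \<noteq> 0"
    by (simp only: ennreal_eq_0_iff not_le)
  then show ?thesis
    unfolding True by (simp only: ennreal_mult_top if_False top_greatest)
next
  case False
  let ?n = "CARD('n)"
  obtain J where J: "?I = ennreal J" "0 \<le> J"
    using False by (cases ?I) auto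
  \<comment> \<open>The witnessing cube need not be centred at \<open>x\<close>, so it is replaced
    by a ball around \<open>x\<close> containing it.\<close>
  have ex: "\<exists>s :: real. 0 < s \<and> ennreal (\<kappa> * s ^ ?n) \<le> (\<integral>\<^sup>+ y \<in> cball x (real ?n * s). ennreal \<bar>f y\<bar> \<partial>lebesgue)" if x: "x \<in> ?E" for x
  proof -
    obtain Q where Q: "Q \<in> cubes" "x \<in> Q"
      "ennreal \<kappa> < (\<integral>\<^sup>+ y \<in> Q. ennreal \<bar>f y\<bar> \<partial>lebesgue) / emeasure lebesgue Q"
      using x unfolding maximal_function_def by (auto simp: less_SUP_iff)
    obtain a s where Q_eq: "Q = cube a s" and s: "0 < s"
      using Q(1) by (rule cubesE)
    let ?IQ = "\<integral>\<^sup>+ y \<in> Q. ennreal \<bar>f y\<bar> \<partial>lebesgue"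
    have "ennreal \<kappa> \<le> ?IQ / ennreal (s ^ ?n)"
      using Q(3) s by (simp add: Q_eq emeasure_cube)
    then have "ennreal \<kappa> * ennreal (s ^ ?n) \<le> ?IQ / ennreal (s ^ ?n) * ennreal (s ^ ?n)"
      by (rule mult_right_mono) simp
    then have "ennreal (\<kappa> * s ^ ?n) \<le> ?IQ"
      using s \<kappa> by (simp add: ennreal_divide_times ennreal_mult)
    also have "\<dots> \<le> (\<integral>\<^sup>+ y \<in> cball x (real ?n * s). ennreal \<bar>f y\<bar> \<partial>lebesgue)"
      using cube_subset_cball[of x a s] Q(2) unfolding Q_eq
      by (intro nn_integral_mono) (auto simp: indicator_def)
    finally have "ennreal (\<kappa> * s ^ ?n) \<le> (\<integral>\<^sup>+ y \<in> cball x (real ?n * s). ennreal \<bar>f y\<bar> \<partial>lebesgue)" .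
    with s show ?thesis
      by (intro exI[of _ s] conjI)
  qed
  define s where "s x = (SOME s :: real. 0 < s \<and>
    ennreal (\<kappa> * s ^ ?n) \<le> (\<integral>\<^sup>+ y \<in> cball x (real ?n * s). ennreal \<bar>f y\<bar> \<partial>lebesgue))" for x
  have s_props: "0 < s x \<and> ennreal (\<kappa> * s x ^ ?n) \<le> (\<integral>\<^sup>+ y \<in> cball x (real ?n * s x). ennreal \<bar>f y\<bar> \<partial>lebesgue)"
    if "x \<in> ?E" for x
    unfolding s_def using ex[OF that] by (rule someI_ex)
  note s = s_props[THEN conjunct1] s_props[THEN conjunct2]
  \<comment> \<open>Vitali's lemma needs uniformly bounded radii. A side of at least 1 is at most
    its own power \<open>s x ^ ?n\<close>, which is at most \<open>J / \<kappa>\<close>.\<close>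
  have bound: "0 < real ?n * s x \<and> real ?n * s x \<le> real ?n * max 1 (J / \<kappa>)" if x: "x \<in> ?E" for x
  proof -
    have "ennreal (\<kappa> * s x ^ ?n) \<le> (\<integral>\<^sup>+ y \<in> cball x (real ?n * s x). ennreal \<bar>f y\<bar> \<partial>lebesgue)"
      using x by (rule s)
    also have "\<dots> \<le> ?I"
      by (intro nn_integral_mono) (auto simp: indicator_def)
    finally have "\<kappa> * s x ^ ?n \<le> J"
      using J by simp
    then have "s x ^ ?n \<le> J / \<kappa>"
      using \<kappa> by (simp add: pos_le_divide_eq mult.commute)
    moreover have "s x \<le> s x ^ ?n" if "1 \<le> s x"
      using that by (intro self_le_power) auto
    ultimately have "s x \<le> max 1 (J / \<kappa>)"
      by (cases "1 \<le> s x") auto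
    then show ?thesis
      using s(1)[OF x] by (intro conjI mult_left_mono) auto
  qed
  show ?thesis
  proof (rule Vitali_covering_lemma_cballs_balls[of ?E "\<lambda>x. real ?n * s x" _ "\<lambda>x. x", OF bound])
    fix C assume C: "countable C" "C \<subseteq> ?E"
      "pairwise (\<lambda>i j. disjnt (cball i (real ?n * s i)) (cball j (real ?n * s j))) C"
      "\<And>i. i \<in> ?E \<Longrightarrow> \<exists>j. j \<in> C \<and> \<not> disjnt (cball i (real ?n * s i)) (cball j (real ?n * s j)) \<and>
         cball i (real ?n * s i) \<subseteq> ball j (5 * (real ?n * s j))"
    define ix where "ix = to_nat_on C"
    define B where "B k = (\<Union>j \<in> {j \<in> C. ix j = k}. cball j (real ?n * s j))" for k
    define B' where "B' k = (\<Union>j \<in> {j \<in> C. ix j = k}. ball j (5 * (real ?n * s j)))" for k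
    have ix: "inj_on ix C"
      unfolding ix_def using C(1) by (rule inj_on_to_nat_on)
    have single: "{j \<in> C. ix j = k} = {} \<or> (\<exists>j\<in>C. {j \<in> C. ix j = k} = {j})" for k
    proof (cases "\<exists>j\<in>C. ix j = k")
      case True
      then obtain j where j: "j \<in> C" "ix j = k" by blast
      then have "{j \<in> C. ix j = k} = {j}"
        using ix by (auto dest: inj_onD)
      with j show ?thesis by blast
    qed blast
    have sets [measurable]: "B k \<in> sets lebesgue" "B' k \<in> sets lebesgue" for k
      unfolding B_def B'_def
      by (intro sets.countable_UN'' countable_subset[OF _ C(1)]; force)+
    have "disjoint_family B"
      unfolding disjoint_family_on_def
    proof (intro ballI impI)
      fix k l :: nat assume "k \<noteq> l"
      have "x \<notin> B l" if xk: "x \<in> B k" for x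
      proof
        assume "x \<in> B l"
        then obtain j where j: "j \<in> C" "ix j = l" "x \<in> cball j (real ?n * s j)"
          unfolding B_def by blast
        obtain i where i: "i \<in> C" "ix i = k" "x \<in> cball i (real ?n * s i)"
          using xk unfolding B_def by blast
        have "i \<noteq> j"
          using i j \<open>k \<noteq> l\<close> by auto
        then have "disjnt (cball i (real ?n * s i)) (cball j (real ?n * s j))"
          by (rule pairwiseD[OF C(3) i(1) j(1)])
        then show False
          using i(3) j(3) unfolding disjnt_iff by blast
      qed
      then show "B k \<inter> B l = {}"
        by blast
    qed
    have le: "emeasure lebesgue (B' k) \<le> ennreal (?W / \<kappa>) * (\<integral>\<^sup>+ y \<in> B k. ennreal \<bar>f y\<bar> \<partial>lebesgue)" for k
      using single[of k]
    proof
      assume "\<exists>j\<in>C. {j \<in> C. ix j = k} = {j}"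
      then obtain j where j: "j \<in> C" "{j \<in> C. ix j = k} = {j}" by blast
      then have jE: "j \<in> ?E"
        using C(2) by blast
      have "emeasure lebesgue (B' k) = emeasure lborel (ball j (5 * (real ?n * s j)))"
        unfolding B'_def j by (simp add: emeasure_completion)
      also have "\<dots> = ennreal (unit_ball_vol (real ?n) * (5 * (real ?n * s j)) ^ ?n)"
        using s(1)[OF jE] by (subst emeasure_ball) auto
      \<comment> \<open>A ball of radius \<open>5 * n * s\<close> has volume
        \<open>?W * s ^ ?n\<close>; this is the origin of \<open>?W\<close>.\<close>
      also have "unit_ball_vol (real ?n) * (5 * (real ?n * s j)) ^ ?n = ?W / \<kappa> * (\<kappa> * s j ^ ?n)"
        using \<kappa> by (simp add: power_mult_distrib)
      also have "ennreal (?W / \<kappa> * (\<kappa> * s j ^ ?n)) = ennreal (?W / \<kappa>) * ennreal (\<kappa> * s j ^ ?n)"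
        using \<kappa> s(1)[OF jE] by (intro ennreal_mult) auto
      also have "\<dots> \<le> ennreal (?W / \<kappa>) * (\<integral>\<^sup>+ y \<in> B k. ennreal \<bar>f y\<bar> \<partial>lebesgue)"
        using s(2)[OF jE] unfolding B_def j by (intro mult_left_mono) auto
      finally show ?thesis .
    next
      assume "{j \<in> C. ix j = k} = {}"
      then have "B' k = {}"
        unfolding B'_def by (simp only: UN_empty)
      then show ?thesis by simp
    qed
    have "?E \<subseteq> (\<Union>k. B' k)"
    proof
      fix x assume "x \<in> ?E"
      then obtain j where j: "j \<in> C" "cball x (real ?n * s x) \<subseteq> ball j (5 * (real ?n * s j))"
        using C(4) by blast
      have "x \<in> cball x (real ?n * s x)"
        using bound[OF \<open>x \<in> ?E\<close>] by simp
      then have "x \<in> ball j (5 * (real ?n * s j))"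
        using j(2) by (rule subsetD[rotated])
      then have "x \<in> B' (ix j)"
        unfolding B'_def using j(1) by blast
      then show "x \<in> (\<Union>k. B' k)"
        by blast
    qed
    then have "emeasure lebesgue ?E \<le> emeasure lebesgue (\<Union>k. B' k)"
      by (rule emeasure_mono) auto
    also have "\<dots> \<le> (\<Sum>k. emeasure lebesgue (B' k))"
      by (rule emeasure_subadditive_countably) auto
    also have "\<dots> \<le> (\<Sum>k. ennreal (?W / \<kappa>) * (\<integral>\<^sup>+ y \<in> B k. ennreal \<bar>f y\<bar> \<partial>lebesgue))"
      by (intro suminf_le le) auto
    also have "\<dots> = ennreal (?W / \<kappa>) * (\<Sum>k. \<integral>\<^sup>+ y \<in> B k. ennreal \<bar>f y\<bar> \<partial>lebesgue)"
      by simp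
    also have "(\<Sum>k. \<integral>\<^sup>+ y \<in> B k. ennreal \<bar>f y\<bar> \<partial>lebesgue) = (\<integral>\<^sup>+ y \<in> (\<Union>k. B k). ennreal \<bar>f y\<bar> \<partial>lebesgue)"
      by (intro nn_integral_disjoint_family[symmetric] \<open>disjoint_family B\<close>) auto
    also have "\<dots> \<le> ?I"
      by (intro nn_integral_mono) (auto simp: indicator_def)
    finally show "emeasure lebesgue ?E \<le> ennreal (?W / \<kappa>) * ?I"
      by (simp add: mult_left_mono)
  qed
qed

text \<open>Pointwise \<open>\<bar>f\<bar>\<close> is at most the truncation plus \<open>c\<close>,
  and \<open>c\<close> is its own average over every cube. Where the maximal function of
  \<open>f\<close> exceeds \<open>2 * c\<close>, that of the truncation thus exceeds
  \<open>c\<close>.\<close>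

lemma maximal_function_truncation:
  fixes f :: "real ^ 'n \<Rightarrow> real"
  assumes [measurable]: "f \<in> borel_measurable lebesgue" and c: "0 \<le> c"
  shows "maximal_function f x \<le> maximal_function (\<lambda>y. if c < \<bar>f y\<bar> then f y else 0) x + ennreal c"
  unfolding maximal_function_def[of f]
proof (rule SUP_least, clarify)
  let ?g = "\<lambda>y. if c < \<bar>f y\<bar> then f y else 0"
  fix Q assume Q: "Q \<in> cubes" "x \<in> Q"
  then obtain a s where Q_eq: "Q = cube a s" and s: "0 < s"
    by (elim cubesE)
  have "(\<integral>\<^sup>+ y \<in> Q. ennreal \<bar>f y\<bar> \<partial>lebesgue)
      \<le> (\<integral>\<^sup>+ y. ennreal \<bar>?g y\<bar> * indicator Q y + ennreal c * indicator Q y \<partial>lebesgue)"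
    by (intro nn_integral_mono) (auto simp: indicator_def ennreal_leI add_increasing2)
  also have "\<dots> = (\<integral>\<^sup>+ y \<in> Q. ennreal \<bar>?g y\<bar> \<partial>lebesgue) + ennreal c * emeasure lebesgue Q"
    unfolding Q_eq by (simp add: nn_integral_add nn_integral_cmult_indicator)
  finally have "(\<integral>\<^sup>+ y \<in> Q. ennreal \<bar>f y\<bar> \<partial>lebesgue) / emeasure lebesgue Q
      \<le> ((\<integral>\<^sup>+ y \<in> Q. ennreal \<bar>?g y\<bar> \<partial>lebesgue) + ennreal c * emeasure lebesgue Q) / emeasure lebesgue Q"
    by (rule divide_right_mono_ennreal)
  also have "\<dots> = (\<integral>\<^sup>+ y \<in> Q. ennreal \<bar>?g y\<bar> \<partial>lebesgue) / emeasure lebesgue Q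
      + ennreal c * emeasure lebesgue Q / emeasure lebesgue Q"
    by (rule add_divide_distrib_ennreal)
  also have "ennreal c * emeasure lebesgue Q / emeasure lebesgue Q = ennreal c"
    using s c by (simp add: Q_eq emeasure_cube divide_ennreal flip: ennreal_mult)
  also have "(\<integral>\<^sup>+ y \<in> Q. ennreal \<bar>?g y\<bar> \<partial>lebesgue) / emeasure lebesgue Q \<le> maximal_function ?g x"
    unfolding maximal_function_def using Q by (intro SUP_upper) auto
  finally show "(\<integral>\<^sup>+ y \<in> Q. ennreal \<bar>f y\<bar> \<partial>lebesgue) / emeasure lebesgue Q \<le> maximal_function ?g x + ennreal c"
    by (simp add: add_right_mono)
qed

text \<open>The layer-cake formula: the square of \<open>m\<close> is the integral of
  \<open>2 * t\<close> over \<open>0 < t < m\<close>.\<close>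

lemma square_le_nn_integral:
  "(m :: ennreal)\<^sup>2 \<le> (\<integral>\<^sup>+ t. (if 0 < t \<and> ennreal t < m then ennreal (2 * t) else 0) \<partial>lborel)" (is "_ \<le> ?R m")
proof -
  have fin: "(ennreal c)\<^sup>2 \<le> ?R m" if c: "0 \<le> c" "ennreal c \<le> m" for c
  proof -
    have "(ennreal c)\<^sup>2 = ennreal (c\<^sup>2 - 0\<^sup>2)"
      using c by (simp add: ennreal_power)
    also have "\<dots> = (\<integral>\<^sup>+ t. ennreal (2 * t) * indicator {0..c} t \<partial>lborel)"
      using c by (subst nn_integral_FTC_Icc[where F = "\<lambda>t. t\<^sup>2"]) (auto intro!: derivative_eq_intros)
    also have "\<dots> \<le> ?R m"
    proof (rule nn_integral_mono_AE)
      have "AE t in lborel. t \<noteq> c"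
        by (rule AE_lborel_singleton)
      then show "AE t in lborel. ennreal (2 * t) * indicator {0..c} t \<le> (if 0 < t \<and> ennreal t < m then ennreal (2 * t) else 0)"
      proof eventually_elim
        case (elim t)
        have "ennreal t < m" if "0 < t" "t < c"
          using that c by (intro order_less_le_trans[OF _ c(2)]) (simp add: ennreal_less_iff)
        then show ?case
          using elim by (auto simp: indicator_def)
      qed
    qed
    finally show ?thesis .
  qed
  show ?thesis
  proof (cases m)
    case (real c)
    then show ?thesis using fin[of c] by simp
  next
    case top
    \<comment> \<open>For \<open>m = top\<close> the finite case applies to every \<open>c\<close>,
      so the integral exceeds every natural number.\<close>
    have "of_nat k \<le> ?R m" for k
    proof -
      have "of_nat k \<le> (of_nat k :: ennreal)\<^sup>2"
        using of_nat_mono[of k "k\<^sup>2", where 'a = ennreal] by (simp add: power2_eq_square)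
      also have "\<dots> \<le> ?R m"
        using fin[of "real k"] top by (simp add: ennreal_of_nat_eq_real_of_nat)
      finally show ?thesis .
    qed
    then have "(SUP k. of_nat k :: ennreal) \<le> ?R m"
      by (intro SUP_least)
    then have "?R m = top"
      unfolding ennreal_SUP_of_nat_eq_top by (rule top.extremum_uniqueI)
    then show ?thesis
      by (simp only: top_greatest)
  qed
qed

text \<open>Marcinkiewicz interpolation: the weak type estimate is applied to \<open>f\<close> truncated at height \<open>t / 2\<close>.\<close>

lemma nn_integral_maximal_function_square:
  fixes f :: "real ^ 'n \<Rightarrow> real"
  assumes f [measurable]: "f \<in> borel_measurable lebesgue"
  defines "W \<equiv> unit_ball_vol (real CARD('n)) * (5 * real CARD('n)) ^ CARD('n)"
  shows "(\<integral>\<^sup>+ x. (maximal_function f x)\<^sup>2 \<partial>lebesgue) \<le> ennreal (8 * W) * (\<integral>\<^sup>+ x. ennreal ((f x)\<^sup>2) \<partial>lebesgue)"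
proof -
  let ?m = "maximal_function f"
  have [measurable]: "?m \<in> borel_measurable lebesgue"
    using f by (rule borel_measurable_maximal_function)
  have W: "0 < W"
    by (simp add: W_def)
  interpret A: sigma_finite_measure "lebesgue :: (real ^ 'n) measure"
    by (rule sigma_finite_lebesgue)
  interpret B: sigma_finite_measure "lborel :: real measure"
    by (rule sigma_finite_lborel)
  interpret P: pair_sigma_finite "lebesgue :: (real ^ 'n) measure" "lborel :: real measure" ..
  have level_set: "{x. ennreal u < h x} \<in> sets lebesgue" if [measurable]: "h \<in> borel_measurable lebesgue"
    for h :: "real ^ 'n \<Rightarrow> ennreal" and u
  proof -
    have "{x \<in> space lebesgue. ennreal u < h x} \<in> sets lebesgue"
      by measurable
    then show ?thesis by simp
  qed
  \<comment> \<open>The weak type bound at height \<open>t / 2\<close> contributes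
    \<open>W / (t / 2)\<close>; multiplied by the layer-cake density \<open>2 * t\<close> it leaves
    \<open>4 * W\<close>, free of \<open>t\<close>.\<close>
  have level: "(\<integral>\<^sup>+ x. (if 0 < t \<and> ennreal t < ?m x then ennreal (2 * t) else 0) \<partial>lebesgue)
      \<le> (\<integral>\<^sup>+ x. (if 0 < t \<and> t / 2 < \<bar>f x\<bar> then ennreal (4 * W) * ennreal \<bar>f x\<bar> else 0) \<partial>lebesgue)" for t
  proof (cases "0 < t")
    case t: True
    let ?g = "\<lambda>y. if t / 2 < \<bar>f y\<bar> then f y else 0"
    have g [measurable]: "?g \<in> borel_measurable lebesgue"
      by measurable
    note [measurable] = borel_measurable_maximal_function[OF g]
    have sub: "{x. ennreal t < ?m x} \<subseteq> {x. ennreal (t / 2) < maximal_function ?g x}"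
    proof clarify
      fix x assume "ennreal t < ?m x"
      also have "\<dots> \<le> maximal_function ?g x + ennreal (t / 2)"
        using t by (intro maximal_function_truncation f) auto
      finally have less: "ennreal t < maximal_function ?g x + ennreal (t / 2)" .
      show "ennreal (t / 2) < maximal_function ?g x"
      proof (rule ccontr)
        assume "\<not> ?thesis"
        then have "maximal_function ?g x + ennreal (t / 2) \<le> ennreal (t / 2) + ennreal (t / 2)"
          by (intro add_right_mono) simp
        also have "\<dots> = ennreal (t / 2 + t / 2)"
          using t by (intro ennreal_plus[symmetric]) auto
        finally show False
          using less by simp
      qed
    qed
    have "(\<integral>\<^sup>+ x. (if 0 < t \<and> ennreal t < ?m x then ennreal (2 * t) else 0) \<partial>lebesgue)
        = (\<integral>\<^sup>+ x. ennreal (2 * t) * indicator {x. ennreal t < ?m x} x \<partial>lebesgue)"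
      using t by (intro nn_integral_cong) (auto simp: indicator_def)
    also have "\<dots> = ennreal (2 * t) * emeasure lebesgue {x. ennreal t < ?m x}"
      by (intro nn_integral_cmult_indicator level_set) fact
    also have "\<dots> \<le> ennreal (2 * t) * emeasure lebesgue {x. ennreal (t / 2) < maximal_function ?g x}"
      by (intro mult_left_mono emeasure_mono sub level_set borel_measurable_maximal_function g) simp
    also have "\<dots> \<le> ennreal (2 * t) * (ennreal (W / (t / 2)) * (\<integral>\<^sup>+ x. ennreal \<bar>?g x\<bar> \<partial>lebesgue))"
      unfolding W_def using t by (intro mult_left_mono maximal_function_weak_type g) auto
    also have "\<dots> = (ennreal (2 * t) * ennreal (W / (t / 2))) * (\<integral>\<^sup>+ x. ennreal \<bar>?g x\<bar> \<partial>lebesgue)"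
      by (simp only: mult.assoc)
    also have "ennreal (2 * t) * ennreal (W / (t / 2)) = ennreal (4 * W)"
      using t W by (subst ennreal_mult[symmetric]) auto
    also have "ennreal (4 * W) * (\<integral>\<^sup>+ x. ennreal \<bar>?g x\<bar> \<partial>lebesgue) = (\<integral>\<^sup>+ x. ennreal (4 * W) * ennreal \<bar>?g x\<bar> \<partial>lebesgue)"
      by (rule nn_integral_cmult[symmetric]) measurable
    also have "\<dots> = (\<integral>\<^sup>+ x. (if 0 < t \<and> t / 2 < \<bar>f x\<bar> then ennreal (4 * W) * ennreal \<bar>f x\<bar> else 0) \<partial>lebesgue)"
      using t by (intro nn_integral_cong) auto
    finally show ?thesis .
  qed simp
  have "(\<integral>\<^sup>+ x. (?m x)\<^sup>2 \<partial>lebesgue)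
      \<le> (\<integral>\<^sup>+ x. (\<integral>\<^sup>+ t. (if 0 < t \<and> ennreal t < ?m x then ennreal (2 * t) else 0) \<partial>lborel) \<partial>lebesgue)"
    by (intro nn_integral_mono square_le_nn_integral)
  also have "\<dots> = (\<integral>\<^sup>+ t. (\<integral>\<^sup>+ x. (if 0 < t \<and> ennreal t < ?m x then ennreal (2 * t) else 0) \<partial>lebesgue) \<partial>lborel)"
    by (rule P.Fubini'[symmetric]) measurable
  also have "\<dots> \<le> (\<integral>\<^sup>+ t. (\<integral>\<^sup>+ x. (if 0 < t \<and> t / 2 < \<bar>f x\<bar> then ennreal (4 * W) * ennreal \<bar>f x\<bar> else 0) \<partial>lebesgue) \<partial>lborel)"
    by (intro nn_integral_mono level)
  also have "\<dots> = (\<integral>\<^sup>+ x. (\<integral>\<^sup>+ t. (if 0 < t \<and> t / 2 < \<bar>f x\<bar> then ennreal (4 * W) * ennreal \<bar>f x\<bar> else 0) \<partial>lborel) \<partial>lebesgue)"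
    by (rule P.Fubini') measurable
  \<comment> \<open>For fixed \<open>x\<close> the variable \<open>t\<close> runs through an
    interval of length \<open>2 * \<bar>f x\<bar>\<close>. This turns
    \<open>4 * W * \<bar>f x\<bar>\<close> into \<open>8 * W\<close> times the square of
    \<open>f x\<close>.\<close>
  also have "\<dots> = (\<integral>\<^sup>+ x. ennreal (8 * W) * ennreal ((f x)\<^sup>2) \<partial>lebesgue)"
  proof (rule nn_integral_cong)
    fix x
    have "(\<integral>\<^sup>+ t. (if 0 < t \<and> t / 2 < \<bar>f x\<bar> then ennreal (4 * W) * ennreal \<bar>f x\<bar> else 0) \<partial>lborel)
        = (\<integral>\<^sup>+ t. ennreal (4 * W) * ennreal \<bar>f x\<bar> * indicator {0 <..< 2 * \<bar>f x\<bar>} t \<partial>lborel)"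
      by (intro nn_integral_cong) (auto simp: indicator_def)
    also have "\<dots> = ennreal (4 * W) * ennreal \<bar>f x\<bar> * ennreal (2 * \<bar>f x\<bar>)"
      by (subst nn_integral_cmult_indicator) auto
    also have "\<dots> = ennreal (4 * W * \<bar>f x\<bar> * (2 * \<bar>f x\<bar>))"
      using W by (simp only: ennreal_mult abs_ge_zero less_imp_le mult_nonneg_nonneg zero_le_numeral)
    also have "4 * W * \<bar>f x\<bar> * (2 * \<bar>f x\<bar>) = 8 * W * (f x)\<^sup>2"
      by (simp add: power2_eq_square)
    also have "ennreal (8 * W * (f x)\<^sup>2) = ennreal (8 * W) * ennreal ((f x)\<^sup>2)"
      using W by (intro ennreal_mult) auto
    finally show "(\<integral>\<^sup>+ t. (if 0 < t \<and> t / 2 < \<bar>f x\<bar> then ennreal (4 * W) * ennreal \<bar>f x\<bar> else 0) \<partial>lborel)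
        = ennreal (8 * W) * ennreal ((f x)\<^sup>2)" .
  qed
  also have "\<dots> = ennreal (8 * W) * (\<integral>\<^sup>+ x. ennreal ((f x)\<^sup>2) \<partial>lebesgue)"
    by (rule nn_integral_cmult) measurable
  finally show ?thesis .
qed

lemma modular_2: "modular (\<lambda>x. 2) f = (\<integral>\<^sup>+ x. ennreal ((f x)\<^sup>2) \<partial>lebesgue)"
proof -
  have "\<bar>y\<bar> powr 2 = y\<^sup>2" for y :: real
    by (cases "y = 0") (auto simp: powr_numeral)
  then show ?thesis
    by (simp add: modular_def)
qed

lemma bounded_operator_maximal_function_2:
  "bounded_operator (maximal_function :: (real ^ 'n \<Rightarrow> real) \<Rightarrow> _) (\<lambda>x. 2) (\<lambda>x. 2)"
proof -
  define W where "W = unit_ball_vol (real CARD('n)) * (5 * real CARD('n)) ^ CARD('n)"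
  have W: "0 < W"
    by (simp add: W_def)
  have scale: "(\<integral>\<^sup>+ x. ennreal ((f x / t)\<^sup>2) \<partial>lebesgue) = ennreal (1 / t\<^sup>2) * (\<integral>\<^sup>+ x. ennreal ((f x)\<^sup>2) \<partial>lebesgue)"
    if [measurable]: "f \<in> borel_measurable lebesgue" for f :: "real ^ 'n \<Rightarrow> real" and t
  proof -
    have "ennreal ((f x / t)\<^sup>2) = ennreal (1 / t\<^sup>2) * ennreal ((f x)\<^sup>2)" for x
      by (simp add: power_divide flip: ennreal_mult)
    then show ?thesis
      by (simp add: nn_integral_cmult)
  qed
  show ?thesis
  \<comment> \<open>The square root appears because the modular with exponent 2 scales
    quadratically.\<close>
  proof (rule bounded_operatorI[of _ "sqrt (8 * W)"])
    show "variable_exponent (\<lambda>x :: real ^ 'n. 2)"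
      by (simp add: variable_exponent_def)
    show "0 < sqrt (8 * W)"
      using W by simp
    show "maximal_function f \<in> borel_measurable lebesgue" if "f \<in> borel_measurable lebesgue" for f :: "real ^ 'n \<Rightarrow> real"
      using that by (rule borel_measurable_maximal_function)
  next
    fix f :: "real ^ 'n \<Rightarrow> real" assume "f \<in> Lvar (\<lambda>x. 2)"
    then obtain t where f [measurable]: "f \<in> borel_measurable lebesgue" and t: "0 < t" "modular (\<lambda>x. 2) (\<lambda>x. \<bar>f x\<bar> / t) < \<infinity>"
      unfolding Lvar_def by blast
    note [measurable] = borel_measurable_maximal_function[OF f]
    have "ennreal (1 / t\<^sup>2) * (\<integral>\<^sup>+ x. ennreal ((f x)\<^sup>2) \<partial>lebesgue) < top"
      using t(2) scale[of "\<lambda>x. \<bar>f x\<bar>" t] by (simp add: modular_2)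
    then have "(\<integral>\<^sup>+ x. ennreal ((f x)\<^sup>2) \<partial>lebesgue) < top"
      using t(1) by (auto simp: ennreal_mult_less_top)
    then have "ennreal (8 * W) * (\<integral>\<^sup>+ x. ennreal ((f x)\<^sup>2) \<partial>lebesgue) < top"
      by (intro ennreal_mult_less_top[THEN iffD2]) auto
    then have "(\<integral>\<^sup>+ x. (maximal_function f x)\<^sup>2 \<partial>lebesgue) \<noteq> \<infinity>"
      using nn_integral_maximal_function_square[OF f, folded W_def] by auto
    then have "AE x in lebesgue. (maximal_function f x)\<^sup>2 \<noteq> \<infinity>"
      by (rule nn_integral_noteq_infinite[rotated]) measurable
    then show "AE x in lebesgue. maximal_function f x < \<infinity>"
      by eventually_elim (auto simp: power2_eq_square less_top[symmetric] ennreal_mult_eq_top_iff)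
  next
    fix f :: "real ^ 'n \<Rightarrow> real" and t :: real
    assume f [measurable]: "f \<in> borel_measurable lebesgue" and t: "0 < t" and le: "modular (\<lambda>x. 2) (\<lambda>x. \<bar>f x\<bar> / t) \<le> 1"
    note [measurable] = borel_measurable_maximal_function[OF f]
    let ?m = "\<lambda>x. enn2real (maximal_function f x)"
    have "modular (\<lambda>x. 2) (\<lambda>x. \<bar>?m x\<bar> / (sqrt (8 * W) * t))
        = ennreal (1 / (8 * W * t\<^sup>2)) * (\<integral>\<^sup>+ x. ennreal ((?m x)\<^sup>2) \<partial>lebesgue)"
      using W scale[of ?m "sqrt (8 * W) * t"] by (simp add: modular_2 power_mult_distrib)
    also have "\<dots> \<le> ennreal (1 / (8 * W * t\<^sup>2)) * (\<integral>\<^sup>+ x. (maximal_function f x)\<^sup>2 \<partial>lebesgue)"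
    proof (intro mult_left_mono nn_integral_mono)
      show "ennreal ((?m x)\<^sup>2) \<le> (maximal_function f x)\<^sup>2" for x
        by (cases "maximal_function f x") (auto simp: ennreal_power)
    qed simp
    also have "\<dots> \<le> ennreal (1 / (8 * W * t\<^sup>2)) * (ennreal (8 * W) * (\<integral>\<^sup>+ x. ennreal ((f x)\<^sup>2) \<partial>lebesgue))"
      using nn_integral_maximal_function_square[OF f, folded W_def] by (rule mult_left_mono) simp
    also have "\<dots> = (ennreal (1 / (8 * W * t\<^sup>2)) * ennreal (8 * W)) * (\<integral>\<^sup>+ x. ennreal ((f x)\<^sup>2) \<partial>lebesgue)"
      by (simp only: mult.assoc)
    also have "ennreal (1 / (8 * W * t\<^sup>2)) * ennreal (8 * W) = ennreal (1 / (8 * W * t\<^sup>2) * (8 * W))"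
      using W by (intro ennreal_mult[symmetric]) auto
    also have "1 / (8 * W * t\<^sup>2) * (8 * W) = 1 / t\<^sup>2"
      using W by (simp add: field_simps)
    also have "ennreal (1 / t\<^sup>2) * (\<integral>\<^sup>+ x. ennreal ((f x)\<^sup>2) \<partial>lebesgue) = modular (\<lambda>x. 2) (\<lambda>x. \<bar>f x\<bar> / t)"
      using scale[of "\<lambda>x. \<bar>f x\<bar>" t] by (simp add: modular_2)
    finally show "modular (\<lambda>x. 2) (\<lambda>x. \<bar>?m x\<bar> / (sqrt (8 * W) * t)) \<le> 1"
      using le by simp
  qed
qed

section \<open>Constant exponents\<close>

lemma exponent_sup_const: "exponent_sup (\<lambda>x. c) = ereal c"
  unfolding exponent_sup_def by (rule esssup_const) (simp add: emeasure_completion)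

lemma exponents_P_const:
  assumes "1 < c"
  shows "(\<lambda>x :: real ^ 'n. c) \<in> exponents_P"
proof -
  have "1 < ereal c"
    using assms by (simp add: one_ereal_def)
  also have "ereal c \<le> exponent_inf (\<lambda>x :: real ^ 'n. c)"
    unfolding exponent_inf_def by (intro Sup_upper) simp
  finally show ?thesis
    using assms by (simp add: exponents_P_def variable_exponent_def exponent_sup_const)
qed

text \<open>The constant exponents for which \<open>q (n - \<beta>) / n = 2\<close>.\<close>

lemma exponent_pairs_B_nonempty:
  assumes \<beta>: "0 < \<beta>" "\<beta> < 1"
  shows "(exponent_pairs_B \<beta> :: ((real ^ 'n \<Rightarrow> real) \<times> (real ^ 'n \<Rightarrow> real)) set) \<noteq> {}"
proof -
  let ?n = "real CARD('n)"
  have "1 \<le> ?n"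
    using zero_less_card_finite[where 'a = 'n] by linarith
  then have n: "\<beta> < ?n" "0 < ?n"
    using \<beta> by linarith+
  \<comment> \<open>Given \<open>q\<close>, this solves \<open>1 / p = 1 / q + \<beta> / n\<close>.
    Both \<open>1 < p\<close> and \<open>\<beta> < n / p\<close> reduce to
    \<open>\<beta> < n\<close>.\<close>
  define p where "p = 2 * ?n / (?n + \<beta>)"
  define q where "q = 2 * ?n / (?n - \<beta>)"
  have p: "1 < p"
    using n \<beta> by (simp add: p_def)
  have q: "1 \<le> q"
    using n \<beta> by (simp add: q_def)
  have "((\<lambda>x. p), (\<lambda>x. q)) \<in> (exponent_pairs_B \<beta> :: ((real ^ 'n \<Rightarrow> real) \<times> (real ^ 'n \<Rightarrow> real)) set)"
    unfolding exponent_pairs_B_def mem_Collect_eq prod.case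
  proof (intro conjI allI)
    show "variable_exponent (\<lambda>x :: real ^ 'n. p)" "variable_exponent (\<lambda>x :: real ^ 'n. q)"
      using p q by (auto simp: variable_exponent_def)
    show "(\<lambda>x :: real ^ 'n. p) \<in> exponents_P"
      using p by (rule exponents_P_const)
    have "\<beta> < ?n / p"
      using n \<beta> by (simp add: p_def)
    then show "ereal \<beta> < ereal ?n / exponent_sup (\<lambda>x :: real ^ 'n. p)"
      using p by (simp add: exponent_sup_const)
    show "1 / q = 1 / p - \<beta> / ?n"
      using n \<beta> by (simp add: p_def q_def field_simps)
    have "q * (?n - \<beta>) / ?n = 2"
      using n by (simp add: q_def)
    then show "(\<lambda>x :: real ^ 'n. q * (?n - \<beta>) / ?n) \<in> exponents_B"
      using exponents_P_const[of 2] bounded_operator_maximal_function_2 by (simp add: exponents_B_def)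
  qed (use \<beta> in auto)
  then show ?thesis by blast
qed

theorem theorem1p1:
  fixes b :: "real ^ 'n \<Rightarrow> real" and \<beta> :: real
  assumes "locally_integrable b" and "0 < \<beta>" and "\<beta> < 1"
  shows "(b \<in> lipschitz_space \<beta> \<longleftrightarrow>
            (\<forall>(p, q) \<in> exponent_pairs_B \<beta>. bounded_operator (maximal_commutator b) p q))
       \<and> (b \<in> lipschitz_space \<beta> \<longleftrightarrow>
            (\<exists>(p, q) \<in> exponent_pairs_B \<beta>. bounded_operator (maximal_commutator b) p q))
       \<and> (b \<in> lipschitz_space \<beta> \<longleftrightarrow>
            (\<exists>(p, q) \<in> exponent_pairs_B \<beta>. oscillation_sup \<beta> q b < \<infinity>))
       \<and> (b \<in> lipschitz_space \<beta> \<longleftrightarrow>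
            (\<forall>(p, q) \<in> exponent_pairs_B \<beta>. oscillation_sup \<beta> q b < \<infinity>))"
proof -
  \<comment> \<open>One pair is needed to pass from the universal assertions (2) and (5) to the
    existential ones (3) and (4).\<close>
  obtain p\<^sub>0 q\<^sub>0 where pq\<^sub>0: "(p\<^sub>0, q\<^sub>0) \<in> (exponent_pairs_B \<beta> :: ((real ^ 'n \<Rightarrow> real) \<times> (real ^ 'n \<Rightarrow> real)) set)"
    using exponent_pairs_B_nonempty[OF assms(2,3)] by auto
  have 12: "bounded_operator (maximal_commutator b) p q"
    if "b \<in> lipschitz_space \<beta>" "(p, q) \<in> exponent_pairs_B \<beta>" for p q
    using that assms by (intro bounded_operator_maximal_commutator[of b \<beta>] locally_integrable_measurable)
  have 15: "oscillation_sup \<beta> q b < \<infinity>"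
    if "b \<in> lipschitz_space \<beta>" "(p, q) \<in> exponent_pairs_B \<beta>" for p q
    using that assms by (intro oscillation_sup_lipschitz) (auto simp: exponent_pairs_B_def)
  have 34: "oscillation_sup \<beta> q b < \<infinity>"
    if "(p, q) \<in> exponent_pairs_B \<beta>" "bounded_operator (maximal_commutator b) p q" for p q
    using assms(1,3) that by (rule oscillation_sup_commutator)
  have 41: "b \<in> lipschitz_space \<beta>"
    if "(p, q) \<in> exponent_pairs_B \<beta>" "oscillation_sup \<beta> q b < \<infinity>" for p q
    using assms that by (rule oscillation_sup_imp_lipschitz)
  show ?thesis
    \<comment> \<open>The implications run from (1) to (2) and (5), from these to (3) and (4)
      through the fixed pair, from (3) to (4), and from (4) back to (1).\<close>
    using pq\<^sub>0 12 15 34 41 by blast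
qed

end
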